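(* Let $M\subset\mathbb{R}^n$ be compact and connected by rectifiable arcs, and assume there exist $\varepsilon_0>0$, $C_1>0$ such that $$d_M(x,y)\le |x-y|+C_1|x-y|^2$$ for all $(x,y)\in M\times M$ satisfying $d_M(x,y)\le\varepsilon_0$. Denote $$\bar C_2:=\inf\left\{\frac{|x-y|}{d_M(x,y)}\colon (x,y)\in M\times M,\ x\ne y\right\}.$$ Let $x_0\in M$, let $\Sigma_k\subset M$ ($k\in\mathbb{N}$) be a sequence of closed sets with $\Sigma_k\to M$ as $k\to\infty$ in the sense of the Hausdorff distance, let $C_2\in(0,\bar C_2]$, let $\varepsilon>0$, and set $$\mathcal{C}_k:=\{f\in C(M;\mathbb{R}^n)\colon f(x_0)=0,\ |f(x)-f(y)|\ge C_2 d_M(x,y)\ \text{for all } \{x,y\}\subset\Sigma_k\},$$ $$\mathcal{C}:=\{f\in C(M;\mathbb{R}^n)\colon f(x_0)=0,\ |f(x)-f(y)|\ge C_2 d_M(x,y)\ \text{for all } \{x,y\}\subset M\}.$$ Then the following assertions hold. (i) The variational problems $$\min\{F_{\varepsilon,k}(f)\colon f\in\mathcal{C}_k\}\qquad (P_k)$$ have solutions for all $k\ge\bar k$, where $\bar k\in\mathbb{N}$ depends only on $\varepsilon$. (ii) If $f_k$ is a solution to $(P_k)$, then there is a subsequence of $\{f_k\}$ (not relabeled) such that $\lim_k f_k=f$ in the sense of uniform convergence, where $f$ solves $$\min\{F_{\varepsilon}(f)\colon f\in\mathcal{C}\}.\qquad (P)$$ Moreover, if $f=\lim_k f_k$, then $f_k(M)\to\Sigma:=f(M)$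 in the sense of Hausdorff distance as $k\to+\infty$. (iii) Every $f$ solving $(P)$ with $\varepsilon<\varepsilon_0$ satisfies $$d_M(x,y)(1-2C_1\varepsilon)\le|f(x)-f(y)|\le d_M(x,y)(1+2C_1\varepsilon)$$ if $d_M(x,y)\le\varepsilon$, and $$d_M(x,y)(1-2C_1\varepsilon)\le d_\Sigma(f(x),f(y))\le d_M(x,y)(1+2C_1\varepsilon)$$ for all $(x,y)\in M\times M$, where $\Sigma:=f(M)$.
   Context: $|\cdot|$ is the Euclidean norm. For a set $S\subset\mathbb{R}^n$ (here $S=M$ or $S=\Sigma$), the geodesic distance is $d_S(u,v):=\inf\{\ell(\theta)\colon \theta\colon[0,1]\to S,\ \theta(0)=u,\ \theta(1)=v\}$, where $\ell(\theta)$ is the Euclidean length of the curve $\theta$. The set $M$ is equipped with $d_M$. "Connected by rectifiable arcs" means that any two points of $M$ are joined by a curve in $M$ of finite length. $C(M;\mathbb{R}^n)$ is the space of continuous functions $M\to\mathbb{R}^n$ with the uniform norm. For $\varepsilon>0$, $k\in\mathbb{N}$ the functionals $F_{\varepsilon,k},F_\varepsilon\colon C(M;\mathbb{R}^n)\to[0,+\infty]$ are $$F_{\varepsilon,k}(f):=\sup\left\{\left|\frac{|f(x)-f(y)|^2}{d_M^2(x,y)}-1\right|\colon \{x,y\}\subset\Sigma_k,\ 0<d_M(x,y)\le\varepsilon\right\},$$ $$F_{\varepsilon}(f):=\sup\left\{\left|\frac{|f(x)-f(y)|^2}{d_M^2(x,y)}-1\right|\colon \{x,y\}\subset M,\ 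0<d_M(x,y)\le\varepsilon\right\}.$$
   Formalization: In (ii) the subsequence is claimed only if {f_k} is equicontinuous on M, since values off Σ_k are uncontrolled and the literal claim fails; solutions equal to f_k on Σ_k up to constants that are equicontinuous are shown to exist, and any uniform limit of a subsequence solves (P). *)

theory Defs
  imports "HOL-Analysis.Analysis"
begin

definition curve_length :: "(real \<Rightarrow> 'a::metric_space) \<Rightarrow> ereal" where
  "curve_length \<theta> =
     (SUP (N, t) \<in> {(N::nat, t::nat \<Rightarrow> real). t 0 = 0 \<and> t N = 1 \<and> mono_on {..N} t}.
        ereal (\<Sum>i<N. dist (\<theta> (t (Suc i))) (\<theta> (t i))))"

definition curves_joining :: "'a::topological_space set \<Rightarrow> 'a \<Rightarrow> 'a \<Rightarrow> (real \<Rightarrow> 'a) set" where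
  "curves_joining S u v =
     {\<theta>. path \<theta> \<and> path_image \<theta> \<subseteq> S \<and> pathstart \<theta> = u \<and> pathfinish \<theta> = v}"

definition rectifiably_connected :: "'a::metric_space set \<Rightarrow> bool" where
  "rectifiably_connected S \<longleftrightarrow>
     (\<forall>u\<in>S. \<forall>v\<in>S. \<exists>\<theta>\<in>curves_joining S u v. curve_length \<theta> < \<infinity>)"

(* Extended-real valued: it is \<infinity> if no curve of finite length in S joins u and v, which
   is not excluded a priori for S = f ` M. *)
definition geodesic_dist :: "'a::metric_space set \<Rightarrow> 'a \<Rightarrow> 'a \<Rightarrow> ereal" where
  "geodesic_dist S u v = (INF \<theta>\<in>curves_joining S u v. curve_length \<theta>)"

(* Equal to \<infinity> if exactly one of the two sets is empty. *)
definition hausdorff_dist :: "'a::metric_space set \<Rightarrow> 'a set \<Rightarrow> ennreal" where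
  "hausdorff_dist A B =
     max (SUP a\<in>A. INF b\<in>B. ennreal (dist a b)) (SUP b\<in>B. INF a\<in>A. ennreal (dist a b))"

(* The infimum of |x - y| / d_M(x, y); it is \<infinity> if M has only one point. *)
definition chord_arc_const :: "'a::real_normed_vector set \<Rightarrow> ereal" where
  "chord_arc_const M =
     (INF (x, y) \<in> {(x, y). x \<in> M \<and> y \<in> M \<and> x \<noteq> y}. ereal (norm (x - y)) / geodesic_dist M x y)"

(* F_{\<epsilon>,k} is distortion M (\<Sigma>_k) \<epsilon> and F_\<epsilon> is distortion M M \<epsilon>: the distance is d_M in both.
   The guard makes d_M(x, y) finite, so real_of_ereal loses nothing; as the values are in
   ennreal, the supremum over an empty set of pairs is 0. *)
definition distortion ::
  "'a::real_normed_vector set \<Rightarrow> 'a set \<Rightarrow> real \<Rightarrow> ('a \<Rightarrow> 'a) \<Rightarrow> ennreal" where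
  "distortion M A \<epsilon> f =
     (SUP (x, y) \<in> {(x, y). x \<in> A \<and> y \<in> A \<and> 0 < geodesic_dist M x y \<and> geodesic_dist M x y \<le> ereal \<epsilon>}.
        ennreal \<bar>(norm (f x - f y))\<^sup>2 / (real_of_ereal (geodesic_dist M x y))\<^sup>2 - 1\<bar>)"

(* The class C_k for A = \<Sigma>_k and the class C for A = M. *)
definition admissible ::
  "'a::real_normed_vector set \<Rightarrow> 'a \<Rightarrow> real \<Rightarrow> 'a set \<Rightarrow> ('a \<Rightarrow> 'a) set" where
  "admissible M x0 C2 A =
     {f. continuous_on M f \<and> f x0 = 0 \<and>
         (\<forall>x\<in>A. \<forall>y\<in>A. ereal C2 * geodesic_dist M x y \<le> ereal (norm (f x - f y)))}"

(* f solves (P_k) for A = \<Sigma>_k and solves (P) for A = M. *)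
definition minimizer ::
  "'a::real_normed_vector set \<Rightarrow> 'a \<Rightarrow> real \<Rightarrow> real \<Rightarrow> 'a set \<Rightarrow> ('a \<Rightarrow> 'a) \<Rightarrow> bool" where
  "minimizer M x0 C2 \<epsilon> A f \<longleftrightarrow>
     is_arg_min (distortion M A \<epsilon>) (\<lambda>g. g \<in> admissible M x0 C2 A) f"

(* Problem (P_k) sees f only through its restriction to \<Sigma>_k: a solution stays a solution if
   it is changed continuously off \<Sigma>_k and x0, so a sequence of solutions need not be precompact
   in C(M); compactness can only be claimed for solutions that are equicontinuous on M. *)
definition equicontinuous_seq ::
  "'a::metric_space set \<Rightarrow> nat set \<Rightarrow> (nat \<Rightarrow> 'a \<Rightarrow> 'b::metric_space) \<Rightarrow> bool" where
  "equicontinuous_seq M K f \<longleftrightarrow>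
     (\<forall>e>0. \<exists>d>0. \<forall>k\<in>K. \<forall>x\<in>M. \<forall>y\<in>M. dist x y < d \<longrightarrow> dist (f k x) (f k y) < e)"

end

theory Submission
  imports Defs "HOL-Complex_Analysis.Great_Picard"
begin

text \<open>
The geodesic distance \<open>d\<close> of \<open>M\<close> is finite. A positive \<open>C2\<close> below the chord-arc constant
gives \<open>norm (x - y) \<le> d x y \<le> norm (x - y) / C2\<close>, so \<open>d\<close> induces the Euclidean topology
and is bounded on \<open>M\<close>; if there is no such \<open>C2\<close>, the assertion is void. The index \<open>kbar\<close>
is chosen, by means of a fixed chord-arc bound \<open>c\<close>, such that for \<open>k \<ge> kbar\<close> every point of
\<open>M\<close> has a point of \<open>S k\<close> within \<open>d\<close>-distance \<open>\<epsilon> / 6\<close>.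

The hypothesis \<open>d \<le> norm (x - y) + C1 * (norm (x - y))^2\<close> at small scale says that chords and
arcs agree to first order. Summed over ever finer partitions it shows that a curve in \<open>M\<close> has
the same length for \<open>d\<close> as for the Euclidean metric (\<open>D_sum_le_curve_length\<close>). Hence \<open>d\<close> has
approximate intermediate points (\<open>intermediate_point\<close>). These two facts carry the geometry.

Compactness. The translated inclusion \<open>x \<mapsto> x - x0\<close> is admissible with distortion at most 1, so
minimizers have distortion at most 1 and do not stretch distances below \<open>\<epsilon>\<close> by more than a
factor 2. A map controlled at scale \<open>\<epsilon>\<close> on an \<open>\<epsilon> / 6\<close>-dense set is controlled at all scales,
by repeated approximate bisection (\<open>coarse_bound\<close>); this gives a Lipschitz constant on \<open>S k\<close>
that does not depend on \<open>k\<close>. The values of a competitor off \<open>S k\<close> do not influence its distortion;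
replacing them by a Lipschitz extension and restoring the value at \<open>x0\<close> by a translation gives an
equally good competitor that is Lipschitz on \<open>M\<close> (\<open>lipschitz_normalization\<close>). The theorem of
Arzela and Ascoli then yields limits of minimizing sequences.

Lower semicontinuity. If \<open>g j\<close> converges uniformly to \<open>h\<close>, the distortion of \<open>h\<close> at a pair
\<open>x, y\<close> is the limit of the distortions of \<open>g j\<close> at pairs tending to \<open>x, y\<close>, which may be taken
in the approximating sets. For \<open>d x y = \<epsilon>\<close> those pairs may lie at distance more than \<open>\<epsilon>\<close>; but intermediate
points show that the pairs with \<open>d x y < \<epsilon>\<close> determine the supremum
(\<open>distortion_le_open_range\<close>). Since a competitor on \<open>M\<close> is one on every \<open>S k\<close>, with no larger
distortion there, limits of minimizers are minimizers (\<open>limit_of_minimizers\<close>).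

Near-isometry. For \<open>\<epsilon> < \<epsilon>0\<close> the inclusion has distortion at most \<open>2 * C1 * \<epsilon>\<close>, hence so
has a minimizer, which gives the bounds for pairs at distance at most \<open>\<epsilon>\<close>. A minimizer is a
homeomorphism onto its image, so curves can be transported in both directions, and summing the
local bounds over fine partitions gives the bounds for the geodesic distances.
\<close>

section \<open>Partitions of the unit interval and length of curves\<close>

definition unit_partition :: "nat \<Rightarrow> (nat \<Rightarrow> real) \<Rightarrow> bool" where
  "unit_partition N t \<longleftrightarrow> t 0 = 0 \<and> t N = 1 \<and> mono_on {..N} t"

lemma unit_partition_stepI:
  assumes "t 0 = 0" "t N = 1" "\<And>i. i < N \<Longrightarrow> t i \<le> t (Suc i)"
  shows "unit_partition N t"
proof -
  have "t i \<le> t j" if "i \<le> j" "j \<le> N" for i j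
    using that
  proof (induction j rule: dec_induct)
    case (step n)
    then show ?case using assms(3)[of n] by simp
  qed simp
  then show ?thesis using assms unfolding unit_partition_def mono_on_def by auto
qed

lemma unit_partition_range:
  assumes "unit_partition N t" "i \<le> N"
  shows "0 \<le> t i" "t i \<le> 1"
proof -
  have "t 0 \<le> t i" "t i \<le> t N"
    using assms mono_onD[of "{..N}" t 0 i] mono_onD[of "{..N}" t i N]
    unfolding unit_partition_def by auto
  then show "0 \<le> t i" "t i \<le> 1" using assms unfolding unit_partition_def by auto
qed

lemma unit_partition_step:
  assumes "unit_partition N t" "i < N"
  shows "t i \<le> t (Suc i)"
  using assms unfolding unit_partition_def mono_on_def by auto

lemma partition_sum_le_curve_length:
  assumes "unit_partition N t"
  shows "ereal (\<Sum>i<N. dist (\<theta> (t (Suc i))) (\<theta> (t i))) \<le> curve_length \<theta>"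
  unfolding curve_length_def
  by (rule SUP_upper2[of "(N,t)"]) (use assms in \<open>auto simp: unit_partition_def\<close>)

lemma curve_length_leI:
  assumes "\<And>N t. unit_partition N t \<Longrightarrow> ereal (\<Sum>i<N. dist (\<theta> (t (Suc i))) (\<theta> (t i))) \<le> B"
  shows "curve_length \<theta> \<le> B"
  unfolding curve_length_def
  by (rule SUP_least) (use assms in \<open>auto simp: unit_partition_def\<close>)

lemma sum_telescoping_triangle:
  fixes g :: "real \<Rightarrow> real \<Rightarrow> real"
  assumes refl: "\<And>a. a \<in> X \<Longrightarrow> g a a = 0"
    and tri: "\<And>a b c. a \<in> X \<Longrightarrow> b \<in> X \<Longrightarrow> c \<in> X \<Longrightarrow> g a c \<le> g a b + g b c"
    and s: "\<And>i. i \<le> n \<Longrightarrow> s i \<in> X"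
  shows "g (s 0) (s n) \<le> (\<Sum>i<n. g (s i) (s (Suc i)))"
  using s
proof (induction n)
  case 0
  then show ?case using refl by simp
next
  case (Suc n)
  have "g (s 0) (s (Suc n)) \<le> g (s 0) (s n) + g (s n) (s (Suc n))"
    using Suc.prems by (intro tri) auto
  also have "g (s 0) (s n) \<le> (\<Sum>i<n. g (s i) (s (Suc i)))"
    using Suc.prems by (intro Suc.IH) auto
  finally show ?case by simp
qed

text \<open>Refinement is expressed by its effect on the sums of all functions that satisfy the triangle
inequality, so that one refinement serves both the Euclidean and the geodesic distance, pulled
back along a curve, as well as the distance of image points.\<close>
definition unit_refinement :: "nat \<Rightarrow> (nat \<Rightarrow> real) \<Rightarrow> nat \<Rightarrow> (nat \<Rightarrow> real) \<Rightarrow> bool" where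
  "unit_refinement N t N' t' \<longleftrightarrow> unit_partition N' t' \<and>
     (\<forall>g :: real \<Rightarrow> real \<Rightarrow> real. (\<forall>a\<in>{0..1}. g a a = 0) \<longrightarrow>
        (\<forall>a\<in>{0..1}. \<forall>b\<in>{0..1}. \<forall>c\<in>{0..1}. g a c \<le> g a b + g b c) \<longrightarrow>
        (\<Sum>i<N. g (t i) (t (Suc i))) \<le> (\<Sum>i<N'. g (t' i) (t' (Suc i))))"

lemma unit_refinement_partition: "unit_refinement N t N' t' \<Longrightarrow> unit_partition N' t'"
  by (simp add: unit_refinement_def)

lemma unit_refinement_sum_le:
  fixes g :: "real \<Rightarrow> real \<Rightarrow> real"
  assumes "unit_refinement N t N' t'"
    and "\<And>a. a \<in> {0..1} \<Longrightarrow> g a a = 0"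
    and "\<And>a b c. a \<in> {0..1} \<Longrightarrow> b \<in> {0..1} \<Longrightarrow> c \<in> {0..1} \<Longrightarrow> g a c \<le> g a b + g b c"
  shows "(\<Sum>i<N. g (t i) (t (Suc i))) \<le> (\<Sum>i<N'. g (t' i) (t' (Suc i)))"
  using assms unfolding unit_refinement_def by blast

text \<open>Every interval of the partition is cut into \<open>K\<close> equal parts. The point with index \<open>i * K + j\<close> is
the \<open>j\<close>-th division point of interval \<open>i\<close>, and the triangle inequality is applied inside each
block of \<open>K\<close> consecutive indices.\<close>
lemma unit_partition_subdivide:
  assumes t: "unit_partition N t" and K: "0 < K"
  obtains N' t' where "unit_refinement N t N' t'"
    and "\<And>i. i < N' \<Longrightarrow> \<bar>t' (Suc i) - t' i\<bar> \<le> 1 / real K"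
proof -
  define t' where "t' m = t (m div K) + real (m mod K) / real K * (t (Suc (m div K)) - t (m div K))" for m
  \<comment> \<open>The formula also holds for \<open>j = K\<close>, where \<open>div\<close> and \<open>mod\<close> already belong to the next interval.\<close>
  have at: "t' (i * K + j) = t i + real j / real K * (t (Suc i) - t i)" if "j \<le> K" for i j
  proof (cases "j = K")
    case True
    then have "i * K + j = Suc i * K" by simp
    then have "(i * K + j) div K = Suc i" "(i * K + j) mod K = 0"
      using K by (metis nonzero_mult_div_cancel_right less_not_refl2, metis mod_mult_self2_is_0)
    then show ?thesis using True K by (simp add: t'_def)
  next
    case False
    then have "(i * K + j) div K = i" "(i * K + j) mod K = j" using that by auto
    then show ?thesis by (simp add: t'_def)
  qed
  have step: "t' (Suc m) - t' m = (t (Suc (m div K)) - t (m div K)) / real K" for m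
  proof -
    have lt: "m mod K < K" using K by simp
    have m: "Suc m = m div K * K + Suc (m mod K)" by simp
    have "t' m = t (m div K) + real (m mod K) / real K * (t (Suc (m div K)) - t (m div K))"
      by (simp add: t'_def)
    moreover have "t' (Suc m) = t (m div K) + real (Suc (m mod K)) / real K * (t (Suc (m div K)) - t (m div K))"
      using at[of "Suc (m mod K)" "m div K"] lt m by (metis Suc_leI)
    ultimately show ?thesis using K by (simp add: field_simps)
  qed
  have lt: "m div K < N" if "m < N * K" for m using that K by (simp add: less_mult_imp_div_less)
  have part: "unit_partition (N * K) t'"
  proof (rule unit_partition_stepI)
    show "t' 0 = 0" using at[of 0 0] t by (simp add: unit_partition_def)
    show "t' (N * K) = 1" using at[of 0 N] t by (simp add: unit_partition_def)
    fix i assume "i < N * K"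
    then have "0 \<le> t' (Suc i) - t' i"
      unfolding step using unit_partition_step[OF t lt] by simp
    then show "t' i \<le> t' (Suc i)" by simp
  qed
  show thesis
  proof (rule that)
    fix i assume "i < N * K"
    then have l: "i div K < N" by (rule lt)
    have "0 \<le> t (Suc (i div K)) - t (i div K)" "t (Suc (i div K)) - t (i div K) \<le> 1"
      using unit_partition_step[OF t l] unit_partition_range[OF t, of "i div K"]
        unit_partition_range[OF t, of "Suc (i div K)"] l by auto
    then show "\<bar>t' (Suc i) - t' i\<bar> \<le> 1 / real K"
      unfolding step by (simp add: divide_right_mono)
  next
    have "(\<Sum>i<N. g (t i) (t (Suc i))) \<le> (\<Sum>i<N * K. g (t' i) (t' (Suc i)))"
      if refl: "\<forall>a\<in>{0..1}. g a a = 0"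
        and tri: "\<forall>a\<in>{0..1}. \<forall>b\<in>{0..1}. \<forall>c\<in>{0..1}. g a c \<le> g a b + g b c"
      for g :: "real \<Rightarrow> real \<Rightarrow> real"
    proof -
      have "g (t i) (t (Suc i)) \<le> (\<Sum>m\<in>{i * K..<i * K + K}. g (t' m) (t' (Suc m)))" if iN: "i < N" for i
      proof -
        have "g (t' (i * K + 0)) (t' (i * K + K)) \<le> (\<Sum>j<K. g (t' (i * K + j)) (t' (i * K + Suc j)))"
        proof (rule sum_telescoping_triangle[of "{0..1}" g K "\<lambda>j. t' (i * K + j)"])
          fix j assume "j \<le> K"
          moreover have "Suc i * K \<le> N * K" using iN by (intro mult_right_mono) auto
          ultimately have "i * K + j \<le> N * K" by simp
          then show "t' (i * K + j) \<in> {0..1}" using unit_partition_range[OF part] by simp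
        qed (use refl tri in auto)
        also have "(\<Sum>j<K. g (t' (i * K + j)) (t' (i * K + Suc j))) =
            (\<Sum>m\<in>{i * K..<i * K + K}. g (t' m) (t' (Suc m)))"
          by (rule sum.reindex_bij_witness[of _ "\<lambda>m. m - i * K" "\<lambda>j. i * K + j"]) auto
        finally show ?thesis using at[of 0 i] at[of K i] K by simp
      qed
      then have "(\<Sum>i<N. g (t i) (t (Suc i))) \<le> (\<Sum>i<N. \<Sum>m\<in>{i * K..<i * K + K}. g (t' m) (t' (Suc m)))"
        by (intro sum_mono) auto
      also have "\<dots> = (\<Sum>i<N * K. g (t' i) (t' (Suc i)))" by (rule sum.nat_group)
      finally show ?thesis .
    qed
    then show "unit_refinement N t (N * K) t'"
      unfolding unit_refinement_def using part by blast
  qed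
qed

lemma dist_endpoints_le_curve_length:
  "ereal (dist (pathstart \<theta>) (pathfinish \<theta>)) \<le> curve_length \<theta>"
  using partition_sum_le_curve_length[of 1 real \<theta>] unit_partition_stepI[of real 1]
  by (simp add: pathstart_def pathfinish_def dist_commute)

lemma curve_length_nonneg: "0 \<le> curve_length \<theta>"
  using order_trans[OF _ dist_endpoints_le_curve_length[of \<theta>], of 0] by simp

text \<open>A partition of the joined curve induces, by clamping at the junction, partitions of both
pieces; an interval that straddles the junction is split by the triangle inequality.\<close>
lemma curve_length_join_le:
  assumes "pathfinish \<alpha> = pathstart \<beta>"
  shows "curve_length (\<alpha> +++ \<beta>) \<le> curve_length \<alpha> + curve_length \<beta>"
proof (rule curve_length_leI)
  fix N t assume t: "unit_partition N t"
  define s where "s i = min 1 (2 * t i)" for i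
  define r where "r i = max 0 (2 * t i - 1)" for i
  have s: "unit_partition N s"
    using t unit_partition_step[OF t]
    by (intro unit_partition_stepI) (fastforce simp: s_def unit_partition_def)+
  have r: "unit_partition N r"
    using t unit_partition_step[OF t]
    by (intro unit_partition_stepI) (fastforce simp: r_def unit_partition_def)+
  have eq: "\<alpha> 1 = \<beta> 0" using assms by (simp add: pathstart_def pathfinish_def)
  have "dist ((\<alpha> +++ \<beta>) (t (Suc i))) ((\<alpha> +++ \<beta>) (t i)) \<le>
      dist (\<alpha> (s (Suc i))) (\<alpha> (s i)) + dist (\<beta> (r (Suc i))) (\<beta> (r i))" if "i < N" for i
  proof -
    have m: "t i \<le> t (Suc i)" using unit_partition_step[OF t that] .
    consider "t (Suc i) \<le> 1/2" | "t i > 1/2" | "t i \<le> 1/2" "1/2 < t (Suc i)" by linarith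
    then show ?thesis
    proof cases
      case 1
      then have "s (Suc i) = 2 * t (Suc i)" "s i = 2 * t i" using m by (auto simp: s_def)
      then show ?thesis using 1 m by (simp add: joinpaths_def)
    next
      case 2 then show ?thesis using m by (simp add: joinpaths_def s_def r_def max_def)
    next
      case 3
      then have "s (Suc i) = 1" "s i = 2 * t i" "r i = 0" "r (Suc i) = 2 * t (Suc i) - 1"
        by (auto simp: s_def r_def)
      moreover have "dist (\<beta> (2 * t (Suc i) - 1)) (\<alpha> (2 * t i)) \<le>
          dist (\<beta> (2 * t (Suc i) - 1)) (\<beta> 0) + dist (\<beta> 0) (\<alpha> (2 * t i))"
        by (rule dist_triangle)
      ultimately show ?thesis using 3 eq by (simp add: joinpaths_def)
    qed
  qed
  then have "ereal (\<Sum>i<N. dist ((\<alpha> +++ \<beta>) (t (Suc i))) ((\<alpha> +++ \<beta>) (t i))) \<le>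
      ereal (\<Sum>i<N. dist (\<alpha> (s (Suc i))) (\<alpha> (s i))) + ereal (\<Sum>i<N. dist (\<beta> (r (Suc i))) (\<beta> (r i)))"
    by (auto simp: sum.distrib[symmetric] intro!: sum_mono)
  also have "\<dots> \<le> curve_length \<alpha> + curve_length \<beta>"
    by (intro add_mono partition_sum_le_curve_length s r)
  finally show "ereal (\<Sum>i<N. dist ((\<alpha> +++ \<beta>) (t (Suc i))) ((\<alpha> +++ \<beta>) (t i))) \<le> \<dots>" .
qed

lemma curve_length_reversepath_le: "curve_length (reversepath \<theta>) \<le> curve_length \<theta>"
proof (rule curve_length_leI)
  fix N t assume t: "unit_partition N t"
  define s where "s i = 1 - t (N - i)" for i
  have s: "unit_partition N s"
  proof (rule unit_partition_stepI)
    fix i assume "i < N"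
    then show "s i \<le> s (Suc i)"
      using unit_partition_step[OF t, of "N - Suc i"] by (simp add: s_def Suc_diff_Suc)
  qed (use t in \<open>auto simp: s_def unit_partition_def\<close>)
  have "(\<Sum>i<N. dist (reversepath \<theta> (t (Suc i))) (reversepath \<theta> (t i))) =
      (\<Sum>i<N. dist (\<theta> (s (Suc i))) (\<theta> (s i)))"
    by (rule sum.reindex_bij_witness[of _ "\<lambda>i. N - Suc i" "\<lambda>i. N - Suc i"])
      (auto simp: reversepath_def s_def Suc_diff_Suc dist_commute)
  then show "ereal (\<Sum>i<N. dist (reversepath \<theta> (t (Suc i))) (reversepath \<theta> (t i))) \<le> curve_length \<theta>"
    using partition_sum_le_curve_length[OF s] by simp
qed

lemma geodesic_dist_commute: "geodesic_dist S u v = geodesic_dist S v u"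
proof -
  have "geodesic_dist S u v \<le> geodesic_dist S v u" for u v :: 'a
    unfolding geodesic_dist_def
  proof (rule INF_greatest)
    fix \<theta> assume "\<theta> \<in> curves_joining S v u"
    then have "reversepath \<theta> \<in> curves_joining S u v" by (auto simp: curves_joining_def)
    then show "(INF \<theta>\<in>curves_joining S u v. curve_length \<theta>) \<le> curve_length \<theta>"
      by (rule INF_lower2) (rule curve_length_reversepath_le)
  qed
  then show ?thesis by (intro antisym)
qed

lemma dist_le_geodesic_dist: "ereal (dist u v) \<le> geodesic_dist S u v"
  unfolding geodesic_dist_def
  by (rule INF_greatest) (use dist_endpoints_le_curve_length in \<open>auto simp: curves_joining_def\<close>)

lemma geodesic_dist_refl:
  assumes "u \<in> S" shows "geodesic_dist S u u = 0"
proof (rule antisym)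
  have "curve_length (\<lambda>_::real. u) \<le> 0" by (rule curve_length_leI) simp
  moreover have "(\<lambda>_. u) \<in> curves_joining S u u"
    using assms by (auto simp: curves_joining_def path_def path_image_def pathstart_def pathfinish_def)
  ultimately show "geodesic_dist S u u \<le> 0"
    unfolding geodesic_dist_def by (intro INF_lower2)
  show "0 \<le> geodesic_dist S u u"
    using dist_le_geodesic_dist[of u u S] by (simp add: zero_ereal_def)
qed

lemma geodesic_dist_triangle_real:
  assumes "geodesic_dist S u v = ereal a" "geodesic_dist S v w = ereal b"
  shows "geodesic_dist S u w \<le> ereal (a + b)"
proof (rule ereal_le_epsilon)
  fix e' :: ereal assume "0 < e'"
  then obtain e :: real where e: "e > 0" "ereal e \<le> e'"
    by (metis ereal_dense2 ereal_less(2) less_imp_le)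
  have "geodesic_dist S u v < ereal (a + e/2)" "geodesic_dist S v w < ereal (b + e/2)"
    using assms e by auto
  then obtain \<alpha> \<beta> where \<alpha>: "\<alpha> \<in> curves_joining S u v" "curve_length \<alpha> < ereal (a + e/2)"
    and \<beta>: "\<beta> \<in> curves_joining S v w" "curve_length \<beta> < ereal (b + e/2)"
    unfolding geodesic_dist_def INF_less_iff by blast
  have "\<alpha> +++ \<beta> \<in> curves_joining S u w"
    using \<alpha>(1) \<beta>(1) by (auto simp: curves_joining_def path_image_join)
  then have "geodesic_dist S u w \<le> curve_length (\<alpha> +++ \<beta>)"
    unfolding geodesic_dist_def by (rule INF_lower)
  also have "\<dots> \<le> curve_length \<alpha> + curve_length \<beta>"
    using \<alpha>(1) \<beta>(1) by (intro curve_length_join_le) (auto simp: curves_joining_def)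
  also have "\<dots> \<le> ereal (a + e/2) + ereal (b + e/2)"
    using \<alpha>(2) \<beta>(2) by (intro add_mono) auto
  also have "\<dots> = ereal (a + b) + ereal e" by simp
  also have "\<dots> \<le> ereal (a + b) + e'" using e by (intro add_left_mono)
  finally show "geodesic_dist S u w \<le> ereal (a + b) + e'" .
qed

lemma rectifiably_connected_geodesic_finite:
  assumes "rectifiably_connected M" "x \<in> M" "y \<in> M"
  shows "geodesic_dist M x y = ereal (real_of_ereal (geodesic_dist M x y))"
proof -
  obtain \<theta> where "\<theta> \<in> curves_joining M x y" "curve_length \<theta> < \<infinity>"
    using assms unfolding rectifiably_connected_def by blast
  then have "geodesic_dist M x y < \<infinity>"
    unfolding geodesic_dist_def by (metis INF_lower le_less_trans)
  moreover have "ereal (dist x y) \<le> geodesic_dist M x y" by (rule dist_le_geodesic_dist)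
  then have "geodesic_dist M x y \<noteq> -\<infinity>" by auto
  ultimately show ?thesis by (cases "geodesic_dist M x y") auto
qed

text \<open>The chord-arc constant is an infimum over distinct points only; for \<open>x = y\<close> both sides are 0. This also
covers a set with a single point, whose chord-arc constant is infinite.\<close>
lemma chord_arc_const_lower_bound:
  assumes M: "rectifiably_connected M" and C: "ereal C \<le> chord_arc_const M"
    and xy: "x \<in> M" "y \<in> M"
  shows "ereal C * geodesic_dist M x y \<le> ereal (norm (x - y))"
proof (cases "x = y")
  case True
  then show ?thesis using geodesic_dist_refl[OF xy(2)] by simp
next
  case False
  obtain d where d: "geodesic_dist M x y = ereal d"
    using rectifiably_connected_geodesic_finite[OF M xy] by blast
  have pos: "0 < d"
    using dist_le_geodesic_dist[of x y M] False by (simp add: d order.strict_trans2[of 0 "dist x y"])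
  have "chord_arc_const M \<le> ereal (norm (x - y)) / geodesic_dist M x y"
    unfolding chord_arc_const_def by (rule INF_lower2[of "(x, y)"]) (use xy False in auto)
  with C have "ereal C \<le> ereal (norm (x - y)) / ereal d" unfolding d by (rule order_trans)
  then have "C \<le> norm (x - y) / d" using pos by simp
  then show ?thesis using pos by (simp add: d pos_le_divide_eq)
qed

section \<open>Lipschitz extension and Hausdorff convergence\<close>

text \<open>McShane's extension: the infimum of the cones with slope \<open>L\<close> based on the graph of \<open>u\<close>.\<close>
lemma lipschitz_extension_real:
  fixes u :: "'a::metric_space \<Rightarrow> real"
  assumes L: "0 \<le> L" and u: "\<And>x y. x \<in> A \<Longrightarrow> y \<in> A \<Longrightarrow> \<bar>u x - u y\<bar> \<le> L * dist x y"
  obtains U where "\<And>x. x \<in> A \<Longrightarrow> U x = u x" "\<And>x y. \<bar>U x - U y\<bar> \<le> L * dist x y"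
proof (cases "A = {}")
  case True
  then show thesis using that[of "\<lambda>_. 0"] L by simp
next
  case False
  then obtain a0 where a0: "a0 \<in> A" by blast
  define U where "U x = (INF a\<in>A. u a + L * dist x a)" for x
  have bdd: "bdd_below ((\<lambda>a. u a + L * dist x a) ` A)" for x
  proof (rule bdd_belowI2)
    fix a assume a: "a \<in> A"
    have "L * dist a a0 \<le> L * (dist x a + dist x a0)"
      using L by (intro mult_left_mono) (metis dist_commute dist_triangle)+
    then show "u a0 - L * dist x a0 \<le> u a + L * dist x a"
      using u[OF a a0] by (simp add: algebra_simps)
  qed
  have "U x \<le> U y + L * dist x y" for x y
  proof -
    have "U x - L * dist x y \<le> u a + L * dist y a" if a: "a \<in> A" for a
    proof -
      have "U x \<le> u a + L * dist x a" unfolding U_def by (rule cINF_lower[OF bdd a])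
      also have "L * dist x a \<le> L * (dist x y + dist y a)"
        using L by (intro mult_left_mono dist_triangle)
      finally show ?thesis by (simp add: algebra_simps)
    qed
    then have "U x - L * dist x y \<le> U y" unfolding U_def[of y] by (intro cINF_greatest False)
    then show ?thesis by simp
  qed
  from this this[of y x for x y] have lip: "\<bar>U x - U y\<bar> \<le> L * dist x y" for x y
    by (smt (verit) dist_commute)
  have "U x = u x" if x: "x \<in> A" for x
  proof (rule antisym)
    show "U x \<le> u x" unfolding U_def using cINF_lower[OF bdd x, of x] by simp
    show "u x \<le> U x" unfolding U_def
    proof (rule cINF_greatest[OF False])
      fix a assume "a \<in> A"
      then show "u x \<le> u a + L * dist x a" using u[OF x, of a] by simp
    qed
  qed
  with lip show thesis by (intro that)
qed

text \<open>Extending each coordinate separately costs the factor \<open>DIM('b)\<close>, which is harmless here since only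
a bound common to all maps is wanted.\<close>
lemma lipschitz_extension:
  fixes f :: "'a::real_normed_vector \<Rightarrow> 'b::euclidean_space"
  assumes L: "0 \<le> L" and f: "\<And>x y. x \<in> A \<Longrightarrow> y \<in> A \<Longrightarrow> norm (f x - f y) \<le> L * norm (x - y)"
  obtains F where "\<And>x. x \<in> A \<Longrightarrow> F x = f x"
    "\<And>x y. norm (F x - F y) \<le> real DIM('b) * L * norm (x - y)"
proof -
  have "\<exists>U. (\<forall>x\<in>A. U x = f x \<bullet> b) \<and> (\<forall>x y. \<bar>U x - U y\<bar> \<le> L * norm (x - y))" if b: "b \<in> Basis" for b
  proof -
    have "\<bar>f x \<bullet> b - f y \<bullet> b\<bar> \<le> L * dist x y" if "x \<in> A" "y \<in> A" for x y
      using Basis_le_norm[OF b, of "f x - f y"] f[OF that] by (simp add: inner_diff_left dist_norm)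
    from lipschitz_extension_real[OF L this] show ?thesis unfolding dist_norm by metis
  qed
  then obtain U where U: "\<And>b x. b \<in> Basis \<Longrightarrow> x \<in> A \<Longrightarrow> U b x = f x \<bullet> b"
    "\<And>b x y. b \<in> Basis \<Longrightarrow> \<bar>U b x - U b y\<bar> \<le> L * norm (x - y)"
    by metis
  define F where "F x = (\<Sum>b\<in>Basis. U b x *\<^sub>R b)" for x
  show thesis
  proof (rule that[of F])
    show "F x = f x" if "x \<in> A" for x
      using U(1)[OF _ that] by (simp add: F_def euclidean_representation)
    show "norm (F x - F y) \<le> real DIM('b) * L * norm (x - y)" for x y
    proof -
      have "norm (F x - F y) \<le> (\<Sum>b\<in>Basis. \<bar>(F x - F y) \<bullet> b\<bar>)" by (rule norm_le_l1)
      also have "\<dots> \<le> (\<Sum>b\<in>(Basis :: 'b set). L * norm (x - y))"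
        using U(2) by (intro sum_mono) (simp add: F_def inner_diff_left)
      finally show ?thesis by simp
    qed
  qed
qed

text \<open>Uniform convergence to a necessarily continuous limit allows evaluation at moving points.\<close>
lemma uniform_limit_along:
  fixes g :: "nat \<Rightarrow> 'a::topological_space \<Rightarrow> 'b::real_normed_vector"
  assumes ul: "uniform_limit M g h sequentially"
    and cont: "\<forall>\<^sub>F j in sequentially. continuous_on M (g j)"
    and X: "X \<longlonglongrightarrow> x" "x \<in> M" "\<forall>\<^sub>F j in sequentially. X j \<in> M"
  shows "(\<lambda>j. g j (X j)) \<longlonglongrightarrow> h x"
proof -
  have "continuous_on M h" by (rule uniform_limit_theorem[OF cont ul]) simp
  then have h: "(\<lambda>j. h (X j)) \<longlonglongrightarrow> h x"
    by (rule continuous_on_tendsto_compose) (use X in auto)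
  have "(\<lambda>j. g j (X j) - h (X j)) \<longlonglongrightarrow> 0"
  proof (rule tendstoI)
    fix e :: real assume "0 < e"
    from uniform_limitD[OF ul this] X(3)
    show "\<forall>\<^sub>F j in sequentially. dist (g j (X j) - h (X j)) 0 < e"
      by eventually_elim (simp add: dist_norm)
  qed
  with h show ?thesis by (rule Lim_transform)
qed

lemma hausdorff_dist_uniform_limit:
  assumes "uniform_limit M g h sequentially"
  shows "(\<lambda>j. hausdorff_dist (g j ` M) (h ` M)) \<longlonglongrightarrow> 0"
proof (rule order_tendstoI)
  fix a :: ennreal assume "0 < a"
  then obtain q where q: "0 < q" "q < a" using dense by blast
  then obtain e where e: "q = ennreal e" "0 < e" by (cases q) auto
  from uniform_limitD[OF assms e(2)]
  show "\<forall>\<^sub>F j in sequentially. hausdorff_dist (g j ` M) (h ` M) < a"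
  proof eventually_elim
    case (elim j)
    have "(INF b\<in>h ` M. ennreal (dist (g j x) b)) \<le> q" "(INF b\<in>g j ` M. ennreal (dist b (h x))) \<le> q"
      if "x \<in> M" for x
    proof -
      have d: "ennreal (dist (g j x) (h x)) \<le> q"
        unfolding e(1) using elim that by (intro ennreal_leI less_imp_le) auto
      show "(INF b\<in>h ` M. ennreal (dist (g j x) b)) \<le> q"
        by (rule INF_lower2[of "h x"]) (use that d in auto)
      show "(INF b\<in>g j ` M. ennreal (dist b (h x))) \<le> q"
        by (rule INF_lower2[of "g j x"]) (use that d in auto)
    qed
    then have "hausdorff_dist (g j ` M) (h ` M) \<le> q"
      unfolding hausdorff_dist_def by (intro max.boundedI SUP_least) auto
    then show ?case using q by simp
  qed
qed simp

lemma hausdorff_limit_dense: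
  assumes "(\<lambda>k. hausdorff_dist (S k) M) \<longlonglongrightarrow> 0" "0 < e"
  shows "\<forall>\<^sub>F k in sequentially. \<forall>x\<in>M. \<exists>a\<in>S k. dist a x < e"
proof -
  have "\<forall>\<^sub>F k in sequentially. hausdorff_dist (S k) M < ennreal e"
    using assms by (intro order_tendstoD) auto
  then show ?thesis
  proof eventually_elim
    case (elim k)
    show ?case
    proof
      fix x assume "x \<in> M"
      then have "(INF a\<in>S k. ennreal (dist a x)) \<le> hausdorff_dist (S k) M"
        unfolding hausdorff_dist_def by (intro max.coboundedI2 SUP_upper2[of x]) auto
      also note elim
      finally show "\<exists>a\<in>S k. dist a x < e"
        by (auto simp: INF_less_iff ennreal_less_iff)
    qed
  qed
qed

text \<open>The nearest points of the closed sets \<open>S k\<close> approximate \<open>x\<close>; the first few sets may be empty, so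
membership holds only eventually.\<close>
lemma hausdorff_limit_approximation:
  fixes M :: "'a::heine_borel set"
  assumes lim: "(\<lambda>k. hausdorff_dist (S k) M) \<longlonglongrightarrow> 0" and closed: "\<And>k. closed (S k)"
    and x: "x \<in> M"
  obtains X where "X \<longlonglongrightarrow> x" "\<forall>\<^sub>F k in sequentially. X k \<in> S k"
proof -
  define X where "X k = (SOME a. a \<in> S k \<and> infdist x (S k) = dist x a)" for k
  have X: "X k \<in> S k" "dist x (X k) = infdist x (S k)" if "S k \<noteq> {}" for k
  proof -
    have "\<exists>a. a \<in> S k \<and> infdist x (S k) = dist x a"
      using infdist_attains_inf[OF closed[of k] that, of x] by blast
    then have "X k \<in> S k \<and> infdist x (S k) = dist x (X k)" unfolding X_def by (rule someI_ex)
    then show "X k \<in> S k" "dist x (X k) = infdist x (S k)" by auto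
  qed
  show thesis
  proof (rule that)
    show "\<forall>\<^sub>F k in sequentially. X k \<in> S k"
      using hausdorff_limit_dense[OF lim zero_less_one]
      by eventually_elim (use x X(1) in auto)
    show "X \<longlonglongrightarrow> x"
    proof (rule tendstoI)
      fix e :: real assume "0 < e"
      from hausdorff_limit_dense[OF lim this]
      show "\<forall>\<^sub>F k in sequentially. dist (X k) x < e"
      proof eventually_elim
        case (elim k)
        then obtain a where a: "a \<in> S k" "dist a x < e" using x by blast
        have "S k \<noteq> {}" using a(1) by blast
        then have "dist x (X k) \<le> dist x a" using X(2) infdist_le[OF a(1), of x] by simp
        then show ?case using a by (simp add: dist_commute)
      qed
    qed
  qed
qed

lemma minimizer_iff:
  "minimizer M x0 C2 \<epsilon> A f \<longleftrightarrow> f \<in> admissible M x0 C2 A \<and>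
     (\<forall>g\<in>admissible M x0 C2 A. distortion M A \<epsilon> f \<le> distortion M A \<epsilon> g)"
  by (auto simp: minimizer_def is_arg_min_linorder)

section \<open>The geodesic metric of a chord-arc set\<close>

text \<open>The constant \<open>c\<close> is kept apart from the separation constant \<open>C2\<close> of the variational problem: the
Lipschitz bounds and \<open>kbar\<close> are built from \<open>c\<close> and are therefore uniform in \<open>C2\<close> and \<open>x0\<close>.\<close>
locale chord_arc_set =
  fixes M :: "'a::euclidean_space set" and c \<epsilon>0 C1 :: real
  assumes compact: "compact M"
    and rectifiable: "rectifiably_connected M"
    and c_pos: "0 < c"
    and chord_arc: "\<And>x y. x \<in> M \<Longrightarrow> y \<in> M \<Longrightarrow> ereal c * geodesic_dist M x y \<le> ereal (norm (x - y))"
    and \<epsilon>0_pos: "0 < \<epsilon>0" and C1_pos: "0 < C1"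
    and almost_chordal: "\<And>x y. x \<in> M \<Longrightarrow> y \<in> M \<Longrightarrow> geodesic_dist M x y \<le> ereal \<epsilon>0 \<Longrightarrow>
           geodesic_dist M x y \<le> ereal (norm (x - y) + C1 * (norm (x - y))\<^sup>2)"
begin

definition D :: "'a \<Rightarrow> 'a \<Rightarrow> real" where
  "D x y = real_of_ereal (geodesic_dist M x y)"

lemma geodesic_dist_eq_D:
  assumes "x \<in> M" "y \<in> M"
  shows "geodesic_dist M x y = ereal (D x y)"
  unfolding D_def by (rule rectifiably_connected_geodesic_finite[OF rectifiable assms])

lemma D_commute: "D x y = D y x"
  by (simp add: D_def geodesic_dist_commute)

lemma D_refl: "x \<in> M \<Longrightarrow> D x x = 0"
  by (simp add: D_def geodesic_dist_refl)

lemma D_triangle: "x \<in> M \<Longrightarrow> y \<in> M \<Longrightarrow> z \<in> M \<Longrightarrow> D x z \<le> D x y + D y z"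
  using geodesic_dist_triangle_real[of M x y "D x y" z "D y z"] by (simp add: geodesic_dist_eq_D)

lemma norm_le_D: "x \<in> M \<Longrightarrow> y \<in> M \<Longrightarrow> norm (x - y) \<le> D x y"
  using dist_le_geodesic_dist[of x y M] by (simp add: geodesic_dist_eq_D dist_norm)

lemma D_nonneg: "x \<in> M \<Longrightarrow> y \<in> M \<Longrightarrow> 0 \<le> D x y"
  using norm_le_D order_trans norm_ge_zero by blast

lemma D_pos_iff: "x \<in> M \<Longrightarrow> y \<in> M \<Longrightarrow> 0 < D x y \<longleftrightarrow> x \<noteq> y"
  using norm_le_D[of x y] D_refl[of x] by (metis less_irrefl norm_le_zero_iff not_le order.trans right_minus_eq)

lemma D_le_norm: "x \<in> M \<Longrightarrow> y \<in> M \<Longrightarrow> D x y \<le> norm (x - y) / c"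
  using chord_arc[of x y] c_pos by (simp add: geodesic_dist_eq_D field_simps)

lemma D_almost_chordal:
  "x \<in> M \<Longrightarrow> y \<in> M \<Longrightarrow> D x y \<le> \<epsilon>0 \<Longrightarrow> D x y \<le> norm (x - y) + C1 * (norm (x - y))\<^sup>2"
  using almost_chordal[of x y] by (simp add: geodesic_dist_eq_D)

lemma D_perturb:
  assumes "x \<in> M" "y \<in> M" "x' \<in> M" "y' \<in> M"
  shows "\<bar>D x y - D x' y'\<bar> \<le> (norm (x - x') + norm (y - y')) / c"
proof -
  have "D x y \<le> D x x' + (D x' y' + D y' y)" "D x' y' \<le> D x' x + (D x y + D y y')"
    using assms D_triangle[of x x' y] D_triangle[of x' y' y] D_triangle[of x' x y'] D_triangle[of x y y']
    by auto
  then show ?thesis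
    using D_le_norm[of x x'] D_le_norm[of y y'] assms
    by (auto simp: D_commute[of x' x] D_commute[of y' y] add_divide_distrib)
qed

lemma tendsto_D:
  assumes "(X \<longlongrightarrow> x) F" "(Y \<longlongrightarrow> y) F" "x \<in> M" "y \<in> M"
    "\<forall>\<^sub>F j in F. X j \<in> M" "\<forall>\<^sub>F j in F. Y j \<in> M"
  shows "((\<lambda>j. D (X j) (Y j)) \<longlongrightarrow> D x y) F"
proof -
  have lim: "((\<lambda>j. (norm (X j - x) + norm (Y j - y)) / c) \<longlongrightarrow> (norm (x - x) + norm (y - y)) / c) F"
    using assms c_pos by (intro tendsto_intros) auto
  \<comment> \<open>\<open>D\<close> is Lipschitz for the Euclidean metric by the triangle inequality and the bound by \<open>c\<close>.\<close>
  have "((\<lambda>j. D x y - D (X j) (Y j)) \<longlongrightarrow> 0) F"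
  proof (rule Lim_null_comparison)
    show "((\<lambda>j. (norm (X j - x) + norm (Y j - y)) / c) \<longlongrightarrow> 0) F" using lim by simp
    show "\<forall>\<^sub>F j in F. norm (D x y - D (X j) (Y j)) \<le> (norm (X j - x) + norm (Y j - y)) / c"
      using assms(5,6)
    proof eventually_elim
      case (elim j)
      then show ?case using D_perturb[of x y "X j" "Y j"] assms by (simp add: norm_minus_commute)
    qed
  qed
  from tendsto_diff[OF tendsto_const[of "D x y"] this] show ?thesis by simp
qed

lemma continuous_on_D:
  assumes "continuous_on T f" "continuous_on T g" "f ` T \<subseteq> M" "g ` T \<subseteq> M"
  shows "continuous_on T (\<lambda>t. D (f t) (g t))"
  using assms unfolding continuous_on_def
  by (auto intro!: tendsto_D simp: eventually_at_filter image_subset_iff)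

lemma curve_in_M:
  assumes "\<theta> \<in> curves_joining M x y"
  shows "continuous_on {0..1} \<theta>" "\<And>t. t \<in> {0..1} \<Longrightarrow> \<theta> t \<in> M" "\<theta> 0 = x" "\<theta> 1 = y"
  using assms by (auto simp: curves_joining_def path_def path_image_def pathstart_def pathfinish_def)

text \<open>Uniform continuity of the curve makes the Euclidean steps small, and the chord-arc bound turns
this into small geodesic steps.\<close>
lemma fine_refinement:
  assumes \<theta>: "\<theta> \<in> curves_joining M x y" and t: "unit_partition N t"
    and \<epsilon>: "0 < \<epsilon>" and \<delta>: "0 < \<delta>"
  obtains N' t' where "unit_refinement N t N' t'"
    and "\<And>i. i < N' \<Longrightarrow> D (\<theta> (t' i)) (\<theta> (t' (Suc i))) \<le> \<epsilon>"
    and "\<And>i. i < N' \<Longrightarrow> norm (\<theta> (t' i) - \<theta> (t' (Suc i))) < \<delta>"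
proof -
  note th = curve_in_M[OF \<theta>]
  define \<rho> where "\<rho> = min \<delta> (c * \<epsilon>)"
  have \<rho>: "0 < \<rho>" using c_pos \<epsilon> \<delta> by (simp add: \<rho>_def)
  have "uniformly_continuous_on {0..1} \<theta>"
    using th(1) by (intro compact_uniformly_continuous) auto
  then obtain e where e: "e > 0" "\<And>s t. s \<in> {0..1} \<Longrightarrow> t \<in> {0..1} \<Longrightarrow> dist s t < e \<Longrightarrow> dist (\<theta> s) (\<theta> t) < \<rho>"
    using \<rho> unfolding uniformly_continuous_on_def by metis
  obtain n :: nat where n: "inverse (real (Suc n)) < e"
    using reals_Archimedean[OF e(1)] by blast
  obtain N' t' where t': "unit_refinement N t N' t'"
    "\<And>i. i < N' \<Longrightarrow> \<bar>t' (Suc i) - t' i\<bar> \<le> 1 / real (Suc n)"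
    using unit_partition_subdivide[OF t zero_less_Suc[of n]] by blast
  have r: "t' i \<in> {0..1}" if "i \<le> N'" for i
    using unit_partition_range[OF unit_refinement_partition[OF t'(1)] that] by simp
  have small: "norm (\<theta> (t' i) - \<theta> (t' (Suc i))) < \<rho>" if i: "i < N'" for i
  proof -
    have "dist (t' i) (t' (Suc i)) < e"
      using t'(2)[OF i] n by (simp add: dist_real_def abs_minus_commute inverse_eq_divide)
    with e(2) r i show ?thesis by (simp add: dist_norm)
  qed
  show thesis
  proof (rule that[OF t'(1)])
    fix i assume i: "i < N'"
    show "norm (\<theta> (t' i) - \<theta> (t' (Suc i))) < \<delta>" using small[OF i] by (simp add: \<rho>_def)
    have "D (\<theta> (t' i)) (\<theta> (t' (Suc i))) \<le> norm (\<theta> (t' i) - \<theta> (t' (Suc i))) / c"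
      using r i by (intro D_le_norm th(2)) auto
    also have "\<dots> \<le> \<epsilon>"
      using small[OF i] c_pos by (simp add: \<rho>_def pos_divide_le_eq mult.commute)
    finally show "D (\<theta> (t' i)) (\<theta> (t' (Suc i))) \<le> \<epsilon>" .
  qed
qed

text \<open>Measuring a curve with \<open>D\<close> instead of the smaller Euclidean distance does not make it longer.
After refinement to steps \<open>e < \<delta>\<close> one has \<open>D \<le> e + C1 * e^2 \<le> (1 + C1 * \<delta>) * e\<close>, so the sum exceeds the
Euclidean length by a factor that tends to 1. This replaces additivity of length along the curve.\<close>
lemma D_sum_le_curve_length:
  assumes \<theta>: "\<theta> \<in> curves_joining M x y" and t: "unit_partition N t"
  shows "ereal (\<Sum>i<N. D (\<theta> (t i)) (\<theta> (t (Suc i)))) \<le> curve_length \<theta>"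
proof (cases "curve_length \<theta> = \<infinity>")
  case False
  then obtain l where l: "curve_length \<theta> = ereal l" "0 \<le> l"
    using curve_length_nonneg[of \<theta>] by (cases "curve_length \<theta>") auto
  note th = curve_in_M[OF \<theta>]
  have "(\<Sum>i<N. D (\<theta> (t i)) (\<theta> (t (Suc i)))) \<le> l + e" if e: "e > 0" for e
  proof -
    \<comment> \<open>The denominator has \<open>l + 1\<close> because the length \<open>l\<close> may vanish.\<close>
    define \<delta> where "\<delta> = e / (C1 * (l + 1))"
    have \<delta>: "\<delta> > 0" using C1_pos e l by (simp add: \<delta>_def)
    obtain N' t' where t': "unit_refinement N t N' t'"
      "\<And>i. i < N' \<Longrightarrow> D (\<theta> (t' i)) (\<theta> (t' (Suc i))) \<le> \<epsilon>0"
      "\<And>i. i < N' \<Longrightarrow> norm (\<theta> (t' i) - \<theta> (t' (Suc i))) < \<delta>"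
      using fine_refinement[OF \<theta> t \<epsilon>0_pos \<delta>] by blast
    note part = unit_refinement_partition[OF t'(1)]
    have "(\<Sum>i<N. D (\<theta> (t i)) (\<theta> (t (Suc i)))) \<le> (\<Sum>i<N'. D (\<theta> (t' i)) (\<theta> (t' (Suc i))))"
      by (rule unit_refinement_sum_le[OF t'(1)]) (intro D_refl D_triangle th(2); assumption)+
    also have "\<dots> \<le> (\<Sum>i<N'. (1 + C1 * \<delta>) * dist (\<theta> (t' (Suc i))) (\<theta> (t' i)))"
    proof (rule sum_mono)
      fix i assume "i \<in> {..<N'}"
      then have i: "i < N'" and r: "t' i \<in> {0..1}" "t' (Suc i) \<in> {0..1}"
        using unit_partition_range[OF part] by auto
      let ?e = "norm (\<theta> (t' i) - \<theta> (t' (Suc i)))"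
      have "D (\<theta> (t' i)) (\<theta> (t' (Suc i))) \<le> ?e + C1 * ?e\<^sup>2"
        by (intro D_almost_chordal th(2) r t'(2) i)
      also have "?e\<^sup>2 \<le> \<delta> * ?e" using t'(3)[OF i] by (simp add: power2_eq_square mult_right_mono)
      finally show "D (\<theta> (t' i)) (\<theta> (t' (Suc i))) \<le> (1 + C1 * \<delta>) * dist (\<theta> (t' (Suc i))) (\<theta> (t' i))"
        using C1_pos by (simp add: dist_norm norm_minus_commute algebra_simps)
    qed
    also have "\<dots> = (1 + C1 * \<delta>) * (\<Sum>i<N'. dist (\<theta> (t' (Suc i))) (\<theta> (t' i)))"
      by (simp add: sum_distrib_left)
    also have "\<dots> \<le> (1 + C1 * \<delta>) * l"
      using partition_sum_le_curve_length[OF part, of \<theta>] l \<delta> C1_pos by (intro mult_left_mono) auto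
    also have "\<dots> = l + C1 * \<delta> * l" by (simp add: algebra_simps)
    also have "C1 * \<delta> * l \<le> C1 * \<delta> * (l + 1)" using \<delta> C1_pos by (intro mult_left_mono) auto
    also have "C1 * \<delta> * (l + 1) = e"
    proof -
      have "C1 * (l + 1) \<noteq> 0" using C1_pos l by simp
      then show ?thesis unfolding \<delta>_def by (metis nonzero_eq_divide_eq mult.assoc mult.commute)
    qed
    finally show ?thesis by simp
  qed
  then have "(\<Sum>i<N. D (\<theta> (t i)) (\<theta> (t (Suc i)))) \<le> l" by (rule field_le_epsilon)
  then show ?thesis using l by simp
qed simp

text \<open>On a curve from \<open>x\<close> to \<open>y\<close> of nearly minimal length, the distance to \<open>y\<close> takes the value \<open>s\<close> by
the intermediate value theorem; the rest of the length bounds the distance to \<open>x\<close>.\<close>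
lemma intermediate_point:
  assumes xy: "x \<in> M" "y \<in> M" and s: "0 \<le> s" "s \<le> D x y" and \<eta>: "0 < \<eta>"
  obtains z where "z \<in> M" "D z y = s" "D x z \<le> D x y - s + \<eta>"
proof -
  have "geodesic_dist M x y < ereal (D x y + \<eta>)" using \<eta> by (simp add: geodesic_dist_eq_D xy)
  then obtain \<theta> where \<theta>: "\<theta> \<in> curves_joining M x y" "curve_length \<theta> < ereal (D x y + \<eta>)"
    unfolding geodesic_dist_def INF_less_iff by blast
  note th = curve_in_M[OF \<theta>(1)]
  have "continuous_on {0..1} (\<lambda>t. D (\<theta> t) y)"
    by (rule continuous_on_D[OF th(1) continuous_on_const]) (use th(2) xy in auto)
  moreover have "D (\<theta> 1) y \<le> s" "s \<le> D (\<theta> 0) y"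
    using s D_refl[OF xy(2)] by (simp_all add: th(3,4))
  ultimately obtain \<tau> where \<tau>: "0 \<le> \<tau>" "\<tau> \<le> 1" "D (\<theta> \<tau>) y = s"
    using IVT2'[of "\<lambda>t. D (\<theta> t) y" 1 s 0] by auto
  define t where "t i = (if i = 0 then 0 else if i = 1 then \<tau> else 1)" for i :: nat
  have "unit_partition 2 t"
    by (rule unit_partition_stepI) (use \<tau> in \<open>auto simp: t_def\<close>)
  from D_sum_le_curve_length[OF \<theta>(1) this]
  have "ereal (D x (\<theta> \<tau>) + D (\<theta> \<tau>) y) \<le> curve_length \<theta>"
    by (simp add: t_def numeral_2_eq_2 th(3,4))
  also note \<theta>(2)
  finally have "D x (\<theta> \<tau>) + D (\<theta> \<tau>) y < D x y + \<eta>" by simp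
  moreover have "\<theta> \<tau> \<in> M" using \<tau> by (intro th(2)) simp
  ultimately show thesis using \<tau>(3) that[of "\<theta> \<tau>"] by simp
qed

lemma D_bounded: obtains B where "\<And>x y. x \<in> M \<Longrightarrow> y \<in> M \<Longrightarrow> D x y \<le> B"
proof -
  obtain b where b: "\<And>x. x \<in> M \<Longrightarrow> norm x \<le> b"
    using compact_imp_bounded[OF compact] unfolding bounded_iff by auto
  show thesis
  proof (rule that[of "(b + b) / c"])
    fix x y assume xy: "x \<in> M" "y \<in> M"
    have "D x y \<le> norm (x - y) / c" using xy by (rule D_le_norm)
    also have "norm (x - y) \<le> b + b" using norm_triangle_ineq4[of x y] b[OF xy(1)] b[OF xy(2)] by simp
    finally show "D x y \<le> (b + b) / c" using c_pos by (simp add: divide_right_mono)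
  qed
qed

text \<open>Control at scale \<open>r\<close> on an \<open>r / 6\<close>-dense set propagates to larger scales. For \<open>R \<ge> r\<close> and
\<open>D x y \<le> 5/4 * R\<close>, an approximate midpoint, moved by at most \<open>r / 6\<close> into \<open>A\<close>, has distance at most
\<open>5/8 * R + r / 24 + r / 6 = 5/8 * R + 5/24 * r \<le> R\<close> from \<open>x\<close> and \<open>y\<close>. Thus each doubling of the bound gains the
factor \<open>5/4\<close> in scale.\<close>
lemma coarse_bound:
  fixes f :: "'a \<Rightarrow> 'b::real_normed_vector"
  assumes A: "A \<subseteq> M" and dense: "\<And>z. z \<in> M \<Longrightarrow> \<exists>z'\<in>A. D z z' \<le> r / 6" and r: "0 < r"
    and f: "\<And>x y. x \<in> A \<Longrightarrow> y \<in> A \<Longrightarrow> D x y \<le> r \<Longrightarrow> norm (f x - f y) \<le> B"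
    and xy: "x \<in> A" "y \<in> A" "D x y \<le> (5/4) ^ m * r"
  shows "norm (f x - f y) \<le> 2 ^ m * B"
  using xy
proof (induction m arbitrary: x y)
  case 0
  then show ?case using f by simp
next
  case (Suc m)
  have xy: "x \<in> M" "y \<in> M" using A Suc.prems by auto
  have "0 \<le> D x y" by (intro D_nonneg xy)
  obtain z where z: "z \<in> M" "D z y = D x y / 2" "D x z \<le> D x y - D x y / 2 + r / 24"
    by (rule intermediate_point[OF xy, of "D x y / 2" "r/24"]) (use \<open>0 \<le> D x y\<close> r in auto)
  obtain z' where z': "z' \<in> A" "D z z' \<le> r / 6" using dense z by blast
  have z'M: "z' \<in> M" using z' A by auto
  define R where "R = (5/4) ^ m * r"
  have "1 \<le> (5/4 :: real) ^ m" by (rule one_le_power) simp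
  then have "r \<le> R" using r by (simp add: R_def)
  moreover have "D x y \<le> 5/4 * R" using Suc.prems by (simp add: R_def)
  moreover have "D x z' \<le> D x z + D z z'" "D z' y \<le> D z z' + D z y"
    using D_triangle[of x z z'] D_triangle[of z' z y] xy z z'M by (auto simp: D_commute[of z' z])
  ultimately have "D x z' \<le> R" "D z' y \<le> R" using z(2,3) z'(2) r by linarith+
  then have "norm (f x - f z') \<le> 2 ^ m * B" "norm (f z' - f y) \<le> 2 ^ m * B"
    using Suc.IH[OF Suc.prems(1) z'(1)] Suc.IH[OF z'(1) Suc.prems(2)] by (simp_all add: R_def)
  then show ?case using norm_triangle_ineq[of "f x - f z'" "f z' - f y"] by simp
qed

lemma coarse_exponent:
  assumes "0 < r" obtains m :: nat where "\<And>x y. x \<in> M \<Longrightarrow> y \<in> M \<Longrightarrow> D x y \<le> (5/4) ^ m * r"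
proof -
  obtain B where B: "\<And>x y. x \<in> M \<Longrightarrow> y \<in> M \<Longrightarrow> D x y \<le> B" using D_bounded by blast
  obtain m where "B / r < (5/4) ^ m" using real_arch_pow[of "5/4" "B/r"] by auto
  then have "B \<le> (5/4) ^ m * r" using assms by (simp add: field_simps)
  then show thesis using that[of m] B by (meson order_trans)
qed

section \<open>Uniform Lipschitz bounds for maps of small distortion\<close>

abbreviation stretch_error :: "('a \<Rightarrow> 'a) \<Rightarrow> 'a \<Rightarrow> 'a \<Rightarrow> real" where
  "stretch_error f x y \<equiv> \<bar>(norm (f x - f y))\<^sup>2 / (D x y)\<^sup>2 - 1\<bar>"

lemma distortion_le_iff:
  assumes "A \<subseteq> M"
  shows "distortion M A \<epsilon> f \<le> m \<longleftrightarrow>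
    (\<forall>x\<in>A. \<forall>y\<in>A. 0 < D x y \<and> D x y \<le> \<epsilon> \<longrightarrow> ennreal (stretch_error f x y) \<le> m)"
proof -
  have "x \<in> A \<Longrightarrow> y \<in> A \<Longrightarrow> geodesic_dist M x y = ereal (D x y)" for x y
    using assms geodesic_dist_eq_D by blast
  then show ?thesis
    unfolding distortion_def SUP_le_iff by (auto simp: zero_ereal_def simp flip: D_def)
qed

lemma distortion_le_ennreal_iff:
  assumes "A \<subseteq> M" "0 \<le> m"
  shows "distortion M A \<epsilon> f \<le> ennreal m \<longleftrightarrow>
    (\<forall>x\<in>A. \<forall>y\<in>A. 0 < D x y \<and> D x y \<le> \<epsilon> \<longrightarrow> stretch_error f x y \<le> m)"
  using assms by (simp add: distortion_le_iff)

lemma distortion_mono: "A \<subseteq> B \<Longrightarrow> distortion M A \<epsilon> f \<le> distortion M B \<epsilon> f"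
  unfolding distortion_def by (rule SUP_subset_mono) auto

lemma distortion_translate:
  assumes "\<And>x. x \<in> A \<Longrightarrow> g x = f x + v"
  shows "distortion M A \<epsilon> g = distortion M A \<epsilon> f"
  unfolding distortion_def using assms by (intro SUP_cong) auto

lemma admissible_iff:
  assumes "A \<subseteq> M"
  shows "f \<in> admissible M x0 C2 A \<longleftrightarrow> continuous_on M f \<and> f x0 = 0 \<and>
    (\<forall>x\<in>A. \<forall>y\<in>A. C2 * D x y \<le> norm (f x - f y))"
proof -
  have "x \<in> A \<Longrightarrow> y \<in> A \<Longrightarrow> geodesic_dist M x y = ereal (D x y)" for x y
    using assms geodesic_dist_eq_D by blast
  then show ?thesis unfolding admissible_def by auto
qed

lemma admissible_antimono: "A \<subseteq> B \<Longrightarrow> admissible M x0 C2 B \<subseteq> admissible M x0 C2 A"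
  unfolding admissible_def by auto

lemma inclusion_admissible:
  assumes "A \<subseteq> M" "\<And>x y. x \<in> M \<Longrightarrow> y \<in> M \<Longrightarrow> C2 * D x y \<le> norm (x - y)"
  shows "(\<lambda>x. x - x0) \<in> admissible M x0 C2 A"
  using assms by (auto simp: admissible_iff intro!: continuous_intros)

text \<open>Chords are shorter than arcs, so the squared ratio lies between 0 and 1.\<close>
lemma inclusion_distortion_le_1:
  assumes "A \<subseteq> M"
  shows "distortion M A \<epsilon> (\<lambda>x. x - x0) \<le> 1"
proof -
  have "stretch_error (\<lambda>x. x - x0) x y \<le> 1" if "x \<in> A" "y \<in> A" "0 < D x y" for x y
  proof -
    have "(norm (x - y))\<^sup>2 \<le> (D x y)\<^sup>2" using that assms norm_le_D by (intro power_mono) auto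
    then have "(norm (x - y))\<^sup>2 / (D x y)\<^sup>2 \<le> 1" using that by simp
    moreover have "0 \<le> (norm (x - y))\<^sup>2 / (D x y)\<^sup>2" by simp
    ultimately show ?thesis unfolding diff_diff_eq2 by simp
  qed
  then show ?thesis using distortion_le_ennreal_iff[OF assms, of 1] by simp
qed

lemma minimizer_distortion_le_1:
  assumes A: "A \<subseteq> M"
    and C2: "\<And>x y. x \<in> M \<Longrightarrow> y \<in> M \<Longrightarrow> C2 * D x y \<le> norm (x - y)"
    and f: "minimizer M x0 C2 \<epsilon> A f"
  shows "distortion M A \<epsilon> f \<le> 1"
proof -
  have "distortion M A \<epsilon> f \<le> distortion M A \<epsilon> (\<lambda>x. x - x0)"
    using f inclusion_admissible[OF A C2] by (simp add: minimizer_iff)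
  also have "\<dots> \<le> 1" by (rule inclusion_distortion_le_1[OF A])
  finally show ?thesis .
qed

text \<open>The order of quantifiers is the point: \<open>L\<close> depends on \<open>\<epsilon>\<close> and \<open>M\<close> only. Below scale \<open>\<epsilon>\<close> the
distortion bound gives the Lipschitz constant 2 for \<open>D\<close>; above it, \<open>coarse_bound\<close> bounds the
difference of values by a multiple of \<open>\<epsilon> < D x y\<close>.\<close>
lemma uniform_lipschitz_constant:
  assumes \<epsilon>: "0 < \<epsilon>"
  obtains L where "0 \<le> L"
    "\<And>A f x y. A \<subseteq> M \<Longrightarrow> (\<And>z. z \<in> M \<Longrightarrow> \<exists>z'\<in>A. D z z' \<le> \<epsilon> / 6) \<Longrightarrow> distortion M A \<epsilon> f \<le> 1 \<Longrightarrow>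
       x \<in> A \<Longrightarrow> y \<in> A \<Longrightarrow> norm (f x - f y) \<le> L * norm (x - y)"
proof -
  obtain m where m: "\<And>x y. x \<in> M \<Longrightarrow> y \<in> M \<Longrightarrow> D x y \<le> (5/4) ^ m * \<epsilon>"
    using coarse_exponent[OF \<epsilon>] by blast
  show thesis
  proof (rule that[of "2 ^ m * 2 / c"])
    show "0 \<le> 2 ^ m * 2 / c" using c_pos by simp
    fix A f x y
    assume A: "A \<subseteq> M" and dense: "\<And>z. z \<in> M \<Longrightarrow> \<exists>z'\<in>A. D z z' \<le> \<epsilon> / 6"
      and f: "distortion M A \<epsilon> f \<le> 1" and xy: "x \<in> A" "y \<in> A"
    have near: "norm (f x - f y) \<le> 2 * D x y" if xy: "x \<in> A" "y \<in> A" and "D x y \<le> \<epsilon>" for x y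
    proof (cases "x = y")
      case True
      then show ?thesis using D_refl xy A by auto
    next
      case False
      then have pos: "0 < D x y" using D_pos_iff xy A by auto
      then have "stretch_error f x y \<le> 1"
        using f distortion_le_ennreal_iff[OF A, of 1 \<epsilon> f] that by auto
      then have "(norm (f x - f y))\<^sup>2 / (D x y)\<^sup>2 \<le> 2" by linarith
      then have "(norm (f x - f y))\<^sup>2 \<le> 2 * (D x y)\<^sup>2" using pos by (subst (asm) pos_divide_le_eq) auto
      also have "\<dots> \<le> (2 * D x y)\<^sup>2" by (simp add: power_mult_distrib)
      finally have "(norm (f x - f y))\<^sup>2 \<le> (2 * D x y)\<^sup>2" .
      then show ?thesis by (rule power2_le_imp_le) (use pos in simp)
    qed
    have "norm (f x - f y) \<le> 2 ^ m * 2 * D x y"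
    proof (cases "D x y \<le> \<epsilon>")
      case True
      have "1 * (2 * D x y) \<le> 2 ^ m * (2 * D x y)"
        using D_nonneg[of x y] xy A by (intro mult_right_mono) auto
      then show ?thesis using near[OF xy True] by simp
    next
      case False
      have "norm (f x - f y) \<le> 2 ^ m * (2 * \<epsilon>)"
      proof (rule coarse_bound[OF A dense \<epsilon>, where f = f and x = x and y = y])
        fix x y assume "x \<in> A" "y \<in> A" "D x y \<le> \<epsilon>"
        then show "norm (f x - f y) \<le> 2 * \<epsilon>" using near[of x y] by linarith
      next
        show "D x y \<le> (5/4) ^ m * \<epsilon>" using xy A by (intro m) auto
      qed (use xy in auto)
      also have "\<dots> \<le> 2 ^ m * (2 * D x y)" using False by simp
      finally show ?thesis by simp
    qed
    also have "\<dots> \<le> 2 ^ m * 2 * (norm (x - y) / c)"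
      using D_le_norm xy A by (intro mult_left_mono) auto
    finally show "norm (f x - f y) \<le> 2 ^ m * 2 / c * norm (x - y)" by simp
  qed
qed

text \<open>The base point \<open>x0\<close> need not belong to \<open>A\<close>, so the condition \<open>f x0 = 0\<close> gives no control of \<open>f\<close> on \<open>A\<close>.
Discarding the values off \<open>A\<close>, extending, and translating so that \<open>x0\<close> is mapped to 0 removes this
freedom, while the separation condition and the distortion, which depend on differences of values
on \<open>A\<close> only, stay the same.\<close>
lemma lipschitz_normalization:
  assumes \<epsilon>: "0 < \<epsilon>"
  obtains L where "0 \<le> L"
    "\<And>A f x0 C2. A \<subseteq> M \<Longrightarrow> (\<And>z. z \<in> M \<Longrightarrow> \<exists>z'\<in>A. D z z' \<le> \<epsilon> / 6) \<Longrightarrow> distortion M A \<epsilon> f \<le> 1 \<Longrightarrow>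
       f \<in> admissible M x0 C2 A \<Longrightarrow>
       \<exists>g \<in> admissible M x0 C2 A. distortion M A \<epsilon> g = distortion M A \<epsilon> f \<and>
         (\<exists>v. \<forall>x\<in>A. g x = f x + v) \<and> (\<forall>x y. norm (g x - g y) \<le> L * norm (x - y))"
proof -
  obtain L where L: "0 \<le> L"
    "\<And>A f x y. A \<subseteq> M \<Longrightarrow> (\<And>z. z \<in> M \<Longrightarrow> \<exists>z'\<in>A. D z z' \<le> \<epsilon> / 6) \<Longrightarrow> distortion M A \<epsilon> f \<le> 1 \<Longrightarrow>
       x \<in> A \<Longrightarrow> y \<in> A \<Longrightarrow> norm (f x - f y) \<le> L * norm (x - y)"
    using uniform_lipschitz_constant[OF \<epsilon>] by blast
  show thesis
  proof (rule that[of "real DIM('a) * L"])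
    show "0 \<le> real DIM('a) * L" using L by simp
    fix A f x0 C2
    assume A: "A \<subseteq> M" and dense: "\<And>z. z \<in> M \<Longrightarrow> \<exists>z'\<in>A. D z z' \<le> \<epsilon> / 6"
      and f: "distortion M A \<epsilon> f \<le> 1" "f \<in> admissible M x0 C2 A"
    obtain F where F: "\<And>x. x \<in> A \<Longrightarrow> F x = f x"
      "\<And>x y. norm (F x - F y) \<le> real DIM('a) * L * norm (x - y)"
      using lipschitz_extension[OF L(1) L(2)[OF A dense f(1)]] by blast
    define g where "g x = F x - F x0" for x
    have g: "g x = f x + (- F x0)" if "x \<in> A" for x using F(1)[OF that] by (simp add: g_def)
    have lip: "norm (g x - g y) \<le> real DIM('a) * L * norm (x - y)" for x y
      using F(2) by (simp add: g_def)
    have "(real DIM('a) * L)-lipschitz_on M g"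
      using lip L by (intro lipschitz_onI) (auto simp: dist_norm)
    then have "continuous_on M g" by (rule lipschitz_on_continuous_on)
    moreover have "g x0 = 0" by (simp add: g_def)
    moreover have "norm (g x - g y) = norm (f x - f y)" if "x \<in> A" "y \<in> A" for x y
      by (simp add: g that)
    ultimately have adm: "g \<in> admissible M x0 C2 A"
      using f(2) unfolding admissible_iff[OF A] by (metis (no_types, lifting))
    have ex: "\<exists>v. \<forall>x\<in>A. g x = f x + v" by (intro exI[of _ "- F x0"] ballI g)
    show "\<exists>g \<in> admissible M x0 C2 A. distortion M A \<epsilon> g = distortion M A \<epsilon> f \<and>
         (\<exists>v. \<forall>x\<in>A. g x = f x + v) \<and> (\<forall>x y. norm (g x - g y) \<le> real DIM('a) * L * norm (x - y))"
      by (intro bexI[OF _ adm] conjI ex allI lip distortion_translate[OF g])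
  qed
qed

section \<open>Compactness and lower semicontinuity\<close>

text \<open>The normalization at \<open>x0\<close> gives the uniform bound that the theorem of Arzela and Ascoli
requires: \<open>coarse_bound\<close> with \<open>A = M\<close> turns equicontinuity into a bound on the oscillation.\<close>
lemma equicontinuous_subsequence:
  fixes g :: "nat \<Rightarrow> 'a \<Rightarrow> 'b::{real_normed_vector,heine_borel}"
  assumes eq: "equicontinuous_seq M UNIV g" and x0: "x0 \<in> M" "\<And>n. g n x0 = 0"
  obtains h k where "strict_mono (k :: nat \<Rightarrow> nat)" "uniform_limit M (\<lambda>j. g (k j)) h sequentially"
proof -
  obtain d where d: "0 < d" "\<And>n x y. x \<in> M \<Longrightarrow> y \<in> M \<Longrightarrow> dist x y < d \<Longrightarrow> dist (g n x) (g n y) < 1"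
    using eq unfolding equicontinuous_seq_def by (metis UNIV_I zero_less_one)
  obtain m where m: "\<And>x y. x \<in> M \<Longrightarrow> y \<in> M \<Longrightarrow> D x y \<le> (5/4) ^ m * (d / 2)"
    using coarse_exponent[of "d/2"] d by auto
  have bound: "norm (g n x) \<le> 2 ^ m * 1" if "x \<in> M" for n x
  proof -
    have "norm (g n x - g n x0) \<le> 2 ^ m * 1"
    proof (rule coarse_bound[of M "d/2" "g n" 1 x x0 m])
      show "\<exists>z'\<in>M. D z z' \<le> d / 2 / 6" if "z \<in> M" for z
        using that d by (intro bexI[of _ z]) (auto simp: D_refl)
      show "norm (g n x - g n y) \<le> 1" if "x \<in> M" "y \<in> M" "D x y \<le> d / 2" for x y
        using d(2)[of x y n] norm_le_D[of x y] that d(1) by (simp add: dist_norm)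
    qed (use m d x0 that in auto)
    then show ?thesis using x0 by simp
  qed
  have equi: "\<exists>d. 0 < d \<and> (\<forall>n y. y \<in> M \<and> norm (x - y) < d \<longrightarrow> norm (g n x - g n y) < e)"
    if "x \<in> M" "0 < e" for x and e :: real
    using eq that unfolding equicontinuous_seq_def dist_norm by (metis UNIV_I)
  obtain h k where h: "continuous_on M h" "strict_mono (k :: nat \<Rightarrow> nat)"
    "\<And>e. 0 < e \<Longrightarrow> \<exists>N. \<forall>n x. n \<ge> N \<and> x \<in> M \<longrightarrow> norm (g (k n) x - h x) < e"
    using Arzela_Ascoli[of M g "2 ^ m * 1", OF compact bound equi] by blast
  have "uniform_limit M (\<lambda>j. g (k j)) h sequentially"
    unfolding uniform_limit_sequentially_iff dist_norm using h(3) by meson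
  with h(2) show thesis by (rule that)
qed

lemma lipschitz_equicontinuous:
  assumes "0 \<le> L" "\<And>k x y. k \<in> K \<Longrightarrow> x \<in> M \<Longrightarrow> y \<in> M \<Longrightarrow> norm (g k x - g k y) \<le> L * norm (x - y)"
  shows "equicontinuous_seq M K g"
  unfolding equicontinuous_seq_def
proof (intro allI impI)
  fix e :: real assume e: "0 < e"
  show "\<exists>d>0. \<forall>k\<in>K. \<forall>x\<in>M. \<forall>y\<in>M. dist x y < d \<longrightarrow> dist (g k x) (g k y) < e"
  proof (intro exI[of _ "e / (L + 1)"] conjI ballI impI)
    fix k x y assume k: "k \<in> K" "x \<in> M" "y \<in> M" and d: "dist x y < e / (L + 1)"
    have "dist (g k x) (g k y) \<le> L * dist x y" using assms(2)[OF k] by (simp add: dist_norm)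
    also have "\<dots> \<le> (L + 1) * dist x y" by (intro mult_right_mono) auto
    also have "\<dots> < e" using d assms(1) by (simp add: pos_less_divide_eq mult.commute)
    finally show "dist (g k x) (g k y) < e" .
  qed (use e assms in auto)
qed

lemma tendsto_stretch_error:
  assumes "uniform_limit M g h sequentially" "\<forall>\<^sub>F j in sequentially. continuous_on M (g j)"
    "X \<longlonglongrightarrow> x" "Y \<longlonglongrightarrow> y" "x \<in> M" "y \<in> M"
    "\<forall>\<^sub>F j in sequentially. X j \<in> M" "\<forall>\<^sub>F j in sequentially. Y j \<in> M" "0 < D x y"
  shows "(\<lambda>j. stretch_error (g j) (X j) (Y j)) \<longlonglongrightarrow> stretch_error h x y"
  using assms by (intro tendsto_intros uniform_limit_along[where M = M and g = g and h = h] tendsto_D) auto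

lemma separation_limit:
  assumes ul: "uniform_limit M g h sequentially" and cont: "\<forall>\<^sub>F j in sequentially. continuous_on M (g j)"
    and X: "X \<longlonglongrightarrow> x" "\<forall>\<^sub>F j in sequentially. X j \<in> M" and Y: "Y \<longlonglongrightarrow> y" "\<forall>\<^sub>F j in sequentially. Y j \<in> M"
    and xy: "x \<in> M" "y \<in> M"
    and sep: "\<forall>\<^sub>F j in sequentially. C2 * D (X j) (Y j) \<le> norm (g j (X j) - g j (Y j))"
  shows "C2 * D x y \<le> norm (h x - h y)"
proof (rule tendsto_le[OF _ _ _ sep])
  show "(\<lambda>j. norm (g j (X j) - g j (Y j))) \<longlonglongrightarrow> norm (h x - h y)"
    using assms by (intro tendsto_intros uniform_limit_along[where M = M and g = g and h = h]) auto
  show "(\<lambda>j. C2 * D (X j) (Y j)) \<longlonglongrightarrow> C2 * D x y"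
    using assms by (intro tendsto_intros tendsto_D) auto
qed simp

text \<open>Stated for varying sets so that it serves a minimizing sequence on one set (constant \<open>A\<close>) as well as
solutions on sets that converge to \<open>M\<close>.\<close>
lemma admissible_limit:
  assumes A: "\<And>j. A j \<subseteq> M" "B \<subseteq> M" and x0: "x0 \<in> M"
    and approx: "\<And>x. x \<in> B \<Longrightarrow> \<exists>X. X \<longlonglongrightarrow> x \<and> (\<forall>\<^sub>F j in sequentially. X j \<in> A j)"
    and g: "\<forall>\<^sub>F j in sequentially. g j \<in> admissible M x0 C2 (A j)"
    and ul: "uniform_limit M g h sequentially"
  shows "h \<in> admissible M x0 C2 B"
  unfolding admissible_iff[OF A(2)]
proof (intro conjI ballI)
  have cont: "\<forall>\<^sub>F j in sequentially. continuous_on M (g j)"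
    using g by eventually_elim (simp add: admissible_iff A)
  show "continuous_on M h" by (rule uniform_limit_theorem[OF cont ul]) simp
  have "(\<lambda>j. g j x0) \<longlonglongrightarrow> h x0" using ul x0 by (rule tendsto_uniform_limitI)
  moreover have "\<forall>\<^sub>F j in sequentially. g j x0 = 0"
    using g by eventually_elim (simp add: admissible_iff A)
  ultimately show "h x0 = 0"
    using tendsto_cong[of "\<lambda>j. g j x0" "\<lambda>_. 0"] LIMSEQ_unique[OF _ tendsto_const] by metis
  fix x y assume xy: "x \<in> B" "y \<in> B"
  obtain X where X: "X \<longlonglongrightarrow> x" "\<forall>\<^sub>F j in sequentially. X j \<in> A j" using approx[OF xy(1)] by blast
  obtain Y where Y: "Y \<longlonglongrightarrow> y" "\<forall>\<^sub>F j in sequentially. Y j \<in> A j" using approx[OF xy(2)] by blast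
  show "C2 * D x y \<le> norm (h x - h y)"
  proof (rule separation_limit[OF ul cont X(1) _ Y(1)])
    show "\<forall>\<^sub>F j in sequentially. X j \<in> M"
      by (rule eventually_mono[OF X(2)]) (rule subsetD[OF A(1)])
    show "\<forall>\<^sub>F j in sequentially. Y j \<in> M"
      by (rule eventually_mono[OF Y(2)]) (rule subsetD[OF A(1)])
    show "\<forall>\<^sub>F j in sequentially. C2 * D (X j) (Y j) \<le> norm (g j (X j) - g j (Y j))"
      using g X(2) Y(2) by eventually_elim (simp add: admissible_iff A)
  qed (use xy A in auto)
qed

text \<open>The direct method. Competitors with distortion at most 1 may be replaced by \<open>L\<close>-Lipschitz ones of
the same distortion, and those with larger distortion are beaten by the inclusion; so it suffices to minimize over
the class \<open>G\<close> of \<open>L\<close>-Lipschitz competitors, where minimizing sequences have uniform limits.\<close>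
lemma minimizer_exists:
  assumes A: "A \<subseteq> M" and dense: "\<And>z. z \<in> M \<Longrightarrow> \<exists>z'\<in>A. D z z' \<le> \<epsilon> / 6" and \<epsilon>: "0 < \<epsilon>"
    and x0: "x0 \<in> M" and C2: "\<And>x y. x \<in> M \<Longrightarrow> y \<in> M \<Longrightarrow> C2 * D x y \<le> norm (x - y)"
  shows "\<exists>f. minimizer M x0 C2 \<epsilon> A f"
proof -
  let ?adm = "admissible M x0 C2 A" and ?F = "distortion M A \<epsilon>"
  obtain L where L: "0 \<le> L"
    "\<And>f. ?F f \<le> 1 \<Longrightarrow> f \<in> ?adm \<Longrightarrow>
       \<exists>g \<in> ?adm. ?F g = ?F f \<and>
         (\<exists>v. \<forall>x\<in>A. g x = f x + v) \<and> (\<forall>x y. norm (g x - g y) \<le> L * norm (x - y))"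
    using lipschitz_normalization[OF \<epsilon>] A dense by metis
  define G where "G = {g \<in> ?adm. \<forall>x y. norm (g x - g y) \<le> L * norm (x - y)}"
  have norm: "\<exists>g\<in>G. ?F g = ?F f" if "f \<in> ?adm" "?F f \<le> 1" for f
    using L(2)[OF that(2,1)] unfolding G_def by blast
  obtain g1 where g1: "g1 \<in> G" "?F g1 \<le> 1"
    using norm[OF inclusion_admissible[OF A C2]] inclusion_distortion_le_1[OF A] by metis
  obtain v where v: "decseq v" "range v \<subseteq> ?F ` G" "Inf (?F ` G) = (INF i. v i)"
  proof -
    have "?F ` G \<noteq> {}" using g1(1) by blast
    from ennreal_Inf_countable_INF[OF this] show thesis using that by metis
  qed
  have "\<exists>g. g \<in> G \<and> ?F g = v i" for i
  proof -
    have "v i \<in> ?F ` G" using v(2) by (rule subsetD) (rule rangeI)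
    then show ?thesis by (elim imageE) metis
  qed
  then obtain g where g: "\<And>i. g i \<in> G" "\<And>i. ?F (g i) = v i" by metis
  have adm: "g i \<in> ?adm" for i using g(1) by (simp add: G_def)
  have "equicontinuous_seq M UNIV g"
    by (rule lipschitz_equicontinuous[OF L(1)]) (use g in \<open>auto simp: G_def\<close>)
  moreover have "g i x0 = 0" for i using adm by (simp add: admissible_iff A)
  ultimately obtain h k where k: "strict_mono (k :: nat \<Rightarrow> nat)"
    and h: "uniform_limit M (\<lambda>j. g (k j)) h sequentially"
    using equicontinuous_subsequence[of g x0] x0 by blast
  have "h \<in> ?adm"
  proof (rule admissible_limit[OF _ A x0 _ _ h])
    show "\<exists>X. X \<longlonglongrightarrow> x \<and> (\<forall>\<^sub>F j in sequentially. X j \<in> A)" if "x \<in> A" for x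
      using that by (intro exI[of _ "\<lambda>_. x"]) auto
  qed (use A adm in auto)
  moreover have "?F h \<le> Inf (?F ` G)"
    unfolding distortion_le_iff[OF A]
  proof (intro ballI impI)
    fix x y assume xy: "x \<in> A" "y \<in> A" and D: "0 < D x y \<and> D x y \<le> \<epsilon>"
    have "(\<lambda>j. stretch_error (g (k j)) x y) \<longlonglongrightarrow> stretch_error h x y"
      by (rule tendsto_stretch_error[OF h]) (use xy A D adm in \<open>auto simp: admissible_iff\<close>)
    then have lim: "(\<lambda>j. ennreal (stretch_error (g (k j)) x y)) \<longlonglongrightarrow> ennreal (stretch_error h x y)"
      by (rule tendsto_ennrealI)
    have "v \<longlonglongrightarrow> (INF i. v i)" by (rule LIMSEQ_INF) (rule v(1))
    then have "(\<lambda>j. v (k j)) \<longlonglongrightarrow> (INF i. v i)"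
      using LIMSEQ_subseq_LIMSEQ[OF _ k] by (auto simp: o_def)
    moreover have "ennreal (stretch_error (g (k j)) x y) \<le> v (k j)" for j
      using distortion_le_iff[OF A, of \<epsilon> "g (k j)" "v (k j)"] g(2) xy D by auto
    ultimately show "ennreal (stretch_error h x y) \<le> Inf (?F ` G)"
      unfolding v(3) using tendsto_le[OF _ _ lim] by simp
  qed
  moreover have "Inf (?F ` G) \<le> ?F f" if "f \<in> ?adm" for f
  proof (cases "?F f \<le> 1")
    case True
    then show ?thesis using norm[OF that] by (metis INF_lower)
  next
    case False
    have "Inf (?F ` G) \<le> ?F g1" using g1 by (intro INF_lower)
    then show ?thesis using g1(2) False by auto
  qed
  ultimately have "minimizer M x0 C2 \<epsilon> A h"
    unfolding minimizer_iff by (metis order_trans)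
  then show ?thesis by (rule exI[of _ h])
qed

text \<open>A pair at distance exactly \<open>\<epsilon>\<close> is the limit of pairs \<open>x, z n\<close> at smaller distance: choose \<open>z n\<close> at
distance \<open>s n\<close> from \<open>y\<close> on a curve from \<open>x\<close> to \<open>y\<close> whose length exceeds \<open>D x y\<close> by less than \<open>s n\<close>.\<close>
lemma distortion_le_open_range:
  assumes h: "continuous_on M h"
    and le: "\<And>x y. x \<in> M \<Longrightarrow> y \<in> M \<Longrightarrow> 0 < D x y \<Longrightarrow> D x y < \<epsilon> \<Longrightarrow> ennreal (stretch_error h x y) \<le> m"
  shows "distortion M M \<epsilon> h \<le> m"
  unfolding distortion_le_iff[OF subset_refl]
proof (intro ballI impI)
  fix x y assume xy: "x \<in> M" "y \<in> M" and D: "0 < D x y \<and> D x y \<le> \<epsilon>"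
  \<comment> \<open>With \<open>n + 2\<close> the value \<open>s n\<close> stays strictly below \<open>D x y\<close>, which keeps \<open>z n\<close> away from \<open>x\<close>.\<close>
  define s where "s n = D x y / real (n + 2)" for n :: nat
  have s: "0 < s n" "s n < D x y" for n using D by (auto simp: s_def divide_less_eq)
  have s0: "s \<longlonglongrightarrow> 0" unfolding s_def
    by (rule LIMSEQ_ignore_initial_segment[OF lim_const_over_n])
  have "\<exists>z. z \<in> M \<and> D z y = s n \<and> D x z \<le> D x y - s n + s n / 2" for n
    using intermediate_point[OF xy, of "s n" "s n / 2"] s[of n] by (metis half_gt_zero less_imp_le)
  then obtain z where z: "\<And>n. z n \<in> M" "\<And>n. D (z n) y = s n" "\<And>n. D x (z n) \<le> D x y - s n + s n / 2"
    by metis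
  have "(\<lambda>n. norm (z n - y)) \<longlonglongrightarrow> 0"
    by (rule tendsto_sandwich[OF _ _ tendsto_const s0])
      (use norm_le_D[OF z(1) xy(2)] z(2) in auto)
  then have zy: "z \<longlonglongrightarrow> y" by (simp add: LIM_zero_iff tendsto_norm_zero_iff)
  have lt: "D x (z n) < \<epsilon>" for n using z(3)[of n] s(1)[of n] D by linarith
  have pos: "0 < D x (z n)" for n
  proof -
    have "x \<noteq> z n" using z(2)[of n] s(2)[of n] by auto
    then show ?thesis using D_pos_iff xy z by simp
  qed
  have "(\<lambda>n. stretch_error h x (z n)) \<longlonglongrightarrow> stretch_error h x y"
    by (rule tendsto_stretch_error[where g = "\<lambda>_. h"]) (use h xy zy z D in \<open>auto simp: uniform_limit_iff\<close>)
  then have "(\<lambda>n. ennreal (stretch_error h x (z n))) \<longlonglongrightarrow> ennreal (stretch_error h x y)"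
    by (rule tendsto_ennrealI)
  then show "ennreal (stretch_error h x y) \<le> m"
    by (rule tendsto_upperbound) (use le[OF xy(1) z(1) pos lt] in auto)
qed

text \<open>Any competitor \<open>f\<close> on \<open>M\<close> bounds the distortion of all \<open>g j\<close> by its own distortion on \<open>M\<close>, and pairs
of \<open>A j\<close> that tend to a pair at distance below \<open>\<epsilon>\<close> are eventually seen by the distortion on \<open>A j\<close>.\<close>
lemma limit_of_minimizers:
  assumes A: "\<And>j. A j \<subseteq> M" and x0: "x0 \<in> M"
    and approx: "\<And>x. x \<in> M \<Longrightarrow> \<exists>X. X \<longlonglongrightarrow> x \<and> (\<forall>\<^sub>F j in sequentially. X j \<in> A j)"
    and g: "\<forall>\<^sub>F j in sequentially. minimizer M x0 C2 \<epsilon> (A j) (g j)"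
    and ul: "uniform_limit M g h sequentially"
  shows "minimizer M x0 C2 \<epsilon> M h"
  unfolding minimizer_iff
proof (intro conjI ballI)
  have adm: "\<forall>\<^sub>F j in sequentially. g j \<in> admissible M x0 C2 (A j)"
    using g by eventually_elim (simp add: minimizer_iff)
  then have cont: "\<forall>\<^sub>F j in sequentially. continuous_on M (g j)"
    by eventually_elim (simp add: admissible_iff A)
  show h: "h \<in> admissible M x0 C2 M"
    by (rule admissible_limit[OF A subset_refl x0 approx adm ul])
  fix f assume f: "f \<in> admissible M x0 C2 M"
  have le: "\<forall>\<^sub>F j in sequentially. distortion M (A j) \<epsilon> (g j) \<le> distortion M M \<epsilon> f"
    using g
  proof eventually_elim
    case (elim j)
    have "f \<in> admissible M x0 C2 (A j)" using f admissible_antimono[OF A] by blast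
    then have "distortion M (A j) \<epsilon> (g j) \<le> distortion M (A j) \<epsilon> f" using elim by (simp add: minimizer_iff)
    also have "\<dots> \<le> distortion M M \<epsilon> f" by (rule distortion_mono[OF A])
    finally show ?case .
  qed
  show "distortion M M \<epsilon> h \<le> distortion M M \<epsilon> f"
  proof (rule distortion_le_open_range)
    show "continuous_on M h" using h by (simp add: admissible_iff)
    fix x y assume xy: "x \<in> M" "y \<in> M" and D: "0 < D x y" "D x y < \<epsilon>"
    obtain X where X: "X \<longlonglongrightarrow> x" "\<forall>\<^sub>F j in sequentially. X j \<in> A j" using approx[OF xy(1)] by blast
    obtain Y where Y: "Y \<longlonglongrightarrow> y" "\<forall>\<^sub>F j in sequentially. Y j \<in> A j" using approx[OF xy(2)] by blast
    have M: "\<forall>\<^sub>F j in sequentially. X j \<in> M" "\<forall>\<^sub>F j in sequentially. Y j \<in> M"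
      by (rule eventually_mono[OF X(2)] eventually_mono[OF Y(2)], erule subsetD[OF A])+
    have Dlim: "(\<lambda>j. D (X j) (Y j)) \<longlonglongrightarrow> D x y" by (intro tendsto_D X Y xy M)
    have "(\<lambda>j. ennreal (stretch_error (g j) (X j) (Y j))) \<longlonglongrightarrow> ennreal (stretch_error h x y)"
      by (intro tendsto_ennrealI tendsto_stretch_error[OF ul cont] X Y xy M D)
    then show "ennreal (stretch_error h x y) \<le> distortion M M \<epsilon> f"
    proof (rule tendsto_upperbound)
      show "\<forall>\<^sub>F j in sequentially. ennreal (stretch_error (g j) (X j) (Y j)) \<le> distortion M M \<epsilon> f"
        using le X(2) Y(2) order_tendstoD(1)[OF Dlim D(1)] order_tendstoD(2)[OF Dlim D(2)]
      proof eventually_elim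
        case (elim j)
        then show ?case using distortion_le_iff[OF A, of j \<epsilon> "g j" "distortion M M \<epsilon> f"] by auto
      qed
    qed simp
  qed
qed

text \<open>Off \<open>S k\<close>, solutions are constrained only by continuity and the value at \<open>x0\<close>, so they may fail
to have a uniformly convergent subsequence. Equicontinuity supplies one, and normalized solutions
are always equicontinuous.\<close>
lemma minimizers_along_Hausdorff_limit:
  fixes S :: "nat \<Rightarrow> 'a set"
  assumes \<epsilon>: "0 < \<epsilon>" and closed: "\<And>k. closed (S k)" and sub: "\<And>k. S k \<subseteq> M"
    and lim: "(\<lambda>k. hausdorff_dist (S k) M) \<longlonglongrightarrow> 0"
    and dense: "\<And>k z. kbar \<le> k \<Longrightarrow> z \<in> M \<Longrightarrow> \<exists>a\<in>S k. D z a \<le> \<epsilon> / 6"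
    and x0: "x0 \<in> M" and C2: "\<And>x y. x \<in> M \<Longrightarrow> y \<in> M \<Longrightarrow> C2 * D x y \<le> norm (x - y)"
    and f: "\<forall>k\<ge>kbar. minimizer M x0 C2 \<epsilon> (S k) (f k)"
  shows "equicontinuous_seq M {kbar..} f \<Longrightarrow>
        \<exists>r h. strict_mono r \<and> uniform_limit M (\<lambda>j. f (r j)) h sequentially \<and> minimizer M x0 C2 \<epsilon> M h"
    and "\<exists>g. (\<forall>k\<ge>kbar. minimizer M x0 C2 \<epsilon> (S k) (g k) \<and> (\<exists>v. \<forall>x\<in>S k. g k x = f k x + v)) \<and>
           equicontinuous_seq M {kbar..} g"
    and "\<And>r h. strict_mono r \<Longrightarrow> uniform_limit M (\<lambda>j. f (r j)) h sequentially \<Longrightarrow> minimizer M x0 C2 \<epsilon> M h"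
proof -
  show limit: "minimizer M x0 C2 \<epsilon> M h"
    if r: "strict_mono r" and ul: "uniform_limit M (\<lambda>j. f (r j)) h sequentially" for r h
  proof (rule limit_of_minimizers[OF sub x0 _ _ ul])
    show "\<exists>X. X \<longlonglongrightarrow> x \<and> (\<forall>\<^sub>F j in sequentially. X j \<in> S (r j))" if xM: "x \<in> M" for x
    proof -
      obtain X where X: "X \<longlonglongrightarrow> x" "\<forall>\<^sub>F k in sequentially. X k \<in> S k"
        using hausdorff_limit_approximation[OF lim closed xM] by blast
      have "(X \<circ> r) \<longlonglongrightarrow> x" using X(1) r by (rule LIMSEQ_subseq_LIMSEQ)
      moreover have "\<forall>\<^sub>F j in sequentially. (X \<circ> r) j \<in> S (r j)"
        using eventually_subseq[OF r X(2)] by simp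
      ultimately show ?thesis by blast
    qed
    have "\<forall>\<^sub>F k in sequentially. minimizer M x0 C2 \<epsilon> (S k) (f k)"
      using f by (auto simp: eventually_sequentially)
    from eventually_subseq[OF r this]
    show "\<forall>\<^sub>F j in sequentially. minimizer M x0 C2 \<epsilon> (S (r j)) (f (r j))" .
  qed
  show "\<exists>r h. strict_mono r \<and> uniform_limit M (\<lambda>j. f (r j)) h sequentially \<and> minimizer M x0 C2 \<epsilon> M h"
    if eq: "equicontinuous_seq M {kbar..} f"
  proof -
    \<comment> \<open>The shift by \<open>kbar\<close> discards the initial terms, about which nothing is known.\<close>
    have "f (n + kbar) x0 = 0" for n
      using f[rule_format, of "n + kbar"] by (simp add: minimizer_iff admissible_iff[OF sub])
    moreover have "equicontinuous_seq M UNIV (\<lambda>n. f (n + kbar))"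
      using eq unfolding equicontinuous_seq_def by (metis atLeast_iff le_add2)
    ultimately obtain h k where k: "strict_mono (k :: nat \<Rightarrow> nat)"
      and ul: "uniform_limit M (\<lambda>j. f (k j + kbar)) h sequentially"
      using equicontinuous_subsequence[OF _ x0, of "\<lambda>n. f (n + kbar)"] by metis
    have r: "strict_mono (\<lambda>j. k j + kbar)" using k by (simp add: strict_mono_def)
    from r ul limit[OF r ul] show ?thesis by blast
  qed
  obtain L where L: "0 \<le> L"
    "\<And>k. kbar \<le> k \<Longrightarrow>
       \<exists>g \<in> admissible M x0 C2 (S k). distortion M (S k) \<epsilon> g = distortion M (S k) \<epsilon> (f k) \<and>
         (\<exists>v. \<forall>x\<in>S k. g x = f k x + v) \<and> (\<forall>x y. norm (g x - g y) \<le> L * norm (x - y))"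
  proof -
    obtain L where L: "0 \<le> L"
      "\<And>A f x0 C2. A \<subseteq> M \<Longrightarrow> (\<And>z. z \<in> M \<Longrightarrow> \<exists>z'\<in>A. D z z' \<le> \<epsilon> / 6) \<Longrightarrow> distortion M A \<epsilon> f \<le> 1 \<Longrightarrow>
         f \<in> admissible M x0 C2 A \<Longrightarrow>
         \<exists>g \<in> admissible M x0 C2 A. distortion M A \<epsilon> g = distortion M A \<epsilon> f \<and>
           (\<exists>v. \<forall>x\<in>A. g x = f x + v) \<and> (\<forall>x y. norm (g x - g y) \<le> L * norm (x - y))"
      using lipschitz_normalization[OF \<epsilon>] by blast
    show thesis
    proof (rule that[OF L(1)])
      fix k assume k: "kbar \<le> k"
      have m: "minimizer M x0 C2 \<epsilon> (S k) (f k)" using f k by blast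
      have "f k \<in> admissible M x0 C2 (S k)" using m by (simp add: minimizer_iff)
      from L(2)[OF sub dense[OF k] minimizer_distortion_le_1[OF sub C2 m] this]
      show "\<exists>g \<in> admissible M x0 C2 (S k). distortion M (S k) \<epsilon> g = distortion M (S k) \<epsilon> (f k) \<and>
         (\<exists>v. \<forall>x\<in>S k. g x = f k x + v) \<and> (\<forall>x y. norm (g x - g y) \<le> L * norm (x - y))" .
    qed
  qed
  then obtain g where g: "\<And>k. kbar \<le> k \<Longrightarrow> g k \<in> admissible M x0 C2 (S k)"
    "\<And>k. kbar \<le> k \<Longrightarrow> distortion M (S k) \<epsilon> (g k) = distortion M (S k) \<epsilon> (f k)"
    "\<And>k. kbar \<le> k \<Longrightarrow> \<exists>v. \<forall>x\<in>S k. g k x = f k x + v"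
    "\<And>k x y. kbar \<le> k \<Longrightarrow> norm (g k x - g k y) \<le> L * norm (x - y)"
    by metis
  have "equicontinuous_seq M {kbar..} g"
    by (rule lipschitz_equicontinuous[OF L(1)]) (simp add: g(4))
  moreover have "minimizer M x0 C2 \<epsilon> (S k) (g k)" if "kbar \<le> k" for k
    using f that g(1,2)[OF that] by (simp add: minimizer_iff)
  ultimately show "\<exists>g. (\<forall>k\<ge>kbar. minimizer M x0 C2 \<epsilon> (S k) (g k) \<and> (\<exists>v. \<forall>x\<in>S k. g k x = f k x + v)) \<and>
           equicontinuous_seq M {kbar..} g"
    using g(3) by (intro exI[of _ g]) simp
qed

section \<open>Near-isometry of minimizers\<close>

text \<open>With \<open>e = norm (x - y) \<le> d = D x y \<le> \<epsilon>\<close>, the defect is \<open>(d^2 - e^2) / d^2\<close>, and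
\<open>d^2 - e^2 = (d - e) * (d + e) \<le> C1 * e^2 * 2 * d \<le> 2 * C1 * \<epsilon> * d^2\<close>.\<close>
lemma inclusion_distortion_small:
  assumes \<epsilon>: "0 < \<epsilon>" "\<epsilon> \<le> \<epsilon>0"
  shows "distortion M M \<epsilon> (\<lambda>x. x - x0) \<le> ennreal (2 * C1 * \<epsilon>)"
proof -
  have "stretch_error (\<lambda>x. x - x0) x y \<le> 2 * C1 * \<epsilon>" if xy: "x \<in> M" "y \<in> M" and D: "0 < D x y" "D x y \<le> \<epsilon>" for x y
  proof -
    define e d where "e = norm (x - y)" and "d = D x y"
    have e: "0 \<le> e" "e \<le> d" and d: "0 < d" "d \<le> \<epsilon>"
      using norm_le_D[OF xy] D by (auto simp: e_def d_def)
    have "d \<le> e + C1 * e\<^sup>2"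
      using D_almost_chordal[OF xy] D \<epsilon> by (simp add: e_def d_def)
    then have "d - e \<le> C1 * e\<^sup>2" by simp
    then have "(d - e) * (d + e) \<le> (C1 * e\<^sup>2) * (2 * d)"
      using e d C1_pos by (intro mult_mono) auto
    also have "e\<^sup>2 \<le> \<epsilon> * d"
      using e d by (simp add: power2_eq_square mult_mono)
    then have "(C1 * e\<^sup>2) * (2 * d) \<le> (C1 * (\<epsilon> * d)) * (2 * d)"
      using C1_pos d by (intro mult_right_mono mult_left_mono) auto
    finally have "d\<^sup>2 - e\<^sup>2 \<le> 2 * C1 * \<epsilon> * d\<^sup>2"
      by (simp add: power2_eq_square algebra_simps)
    then have "(d\<^sup>2 - e\<^sup>2) / d\<^sup>2 \<le> 2 * C1 * \<epsilon>" using d by (intro mult_imp_div_pos_le) auto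
    moreover have "(d\<^sup>2 - e\<^sup>2) / d\<^sup>2 = 1 - e\<^sup>2 / d\<^sup>2" using d by (simp add: diff_divide_distrib)
    moreover have "e\<^sup>2 / d\<^sup>2 \<le> 1" using e d by (simp add: power_mono)
    ultimately show ?thesis by (simp add: e_def d_def)
  qed
  then show ?thesis
    using distortion_le_ennreal_iff[OF subset_refl, of "2 * C1 * \<epsilon>"] C1_pos \<epsilon> by simp
qed

text \<open>A minimizer inherits the distortion bound \<open>a = 2 * C1 * \<epsilon>\<close> of the inclusion, and \<open>1 - a \<le> t^2 \<le> 1 + a\<close> with \<open>t \<ge> 0\<close>
gives \<open>1 - a \<le> t \<le> 1 + a\<close>.\<close>
lemma minimizer_almost_isometric:
  assumes f: "minimizer M x0 C2 \<epsilon> M f" and \<epsilon>: "0 < \<epsilon>" "\<epsilon> \<le> \<epsilon>0"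
    and C2: "\<And>x y. x \<in> M \<Longrightarrow> y \<in> M \<Longrightarrow> C2 * D x y \<le> norm (x - y)"
    and xy: "x \<in> M" "y \<in> M" "D x y \<le> \<epsilon>"
  shows "(1 - 2 * C1 * \<epsilon>) * D x y \<le> norm (f x - f y)" "norm (f x - f y) \<le> (1 + 2 * C1 * \<epsilon>) * D x y"
proof -
  define a n d where "a = 2 * C1 * \<epsilon>" and "n = norm (f x - f y)" and "d = D x y"
  have a: "0 \<le> a" using C1_pos \<epsilon> by (simp add: a_def)
  have d: "0 \<le> d" using D_nonneg xy by (simp add: d_def)
  have n: "0 \<le> n" by (simp add: n_def)
  have "(1 - a) * d \<le> n \<and> n \<le> (1 + a) * d"
  proof (cases "x = y")
    case True
    then show ?thesis using D_refl xy by (simp add: n_def d_def)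
  next
    case False
    then have pos: "0 < d" using D_pos_iff xy by (simp add: d_def)
    have "distortion M M \<epsilon> f \<le> distortion M M \<epsilon> (\<lambda>x. x - x0)"
      using f inclusion_admissible[OF subset_refl C2] by (simp add: minimizer_iff)
    also have "\<dots> \<le> ennreal a" unfolding a_def by (rule inclusion_distortion_small[OF \<epsilon>])
    finally have "stretch_error f x y \<le> a"
      using distortion_le_ennreal_iff[OF subset_refl a, of \<epsilon> f] xy pos by (simp add: d_def)
    then have "n\<^sup>2 / d\<^sup>2 \<le> 1 + a" "1 - a \<le> n\<^sup>2 / d\<^sup>2" unfolding n_def d_def by linarith+
    then have sq: "n\<^sup>2 \<le> (1 + a) * d\<^sup>2" "(1 - a) * d\<^sup>2 \<le> n\<^sup>2"
      using pos by (auto simp: pos_divide_le_eq pos_le_divide_eq)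
    have "(1 + a) * d\<^sup>2 \<le> (1 + a)\<^sup>2 * d\<^sup>2"
      using a by (intro mult_right_mono) (auto simp: power2_eq_square)
    with sq(1) have "n\<^sup>2 \<le> ((1 + a) * d)\<^sup>2" by (simp add: power_mult_distrib)
    then have upper: "n \<le> (1 + a) * d" by (rule power2_le_imp_le) (use a d in simp)
    have lower: "(1 - a) * d \<le> n"
    proof (cases "a \<le> 1")
      case True
      have "(1 - a)\<^sup>2 * d\<^sup>2 \<le> (1 - a) * d\<^sup>2"
        using a True by (intro mult_right_mono) (auto simp: power2_eq_square mult_left_le)
      with sq(2) have "((1 - a) * d)\<^sup>2 \<le> n\<^sup>2" by (simp add: power_mult_distrib)
      then show ?thesis by (rule power2_le_imp_le) (rule n)
    next
      case False
      then have "(1 - a) * d \<le> 0" using d by (simp add: mult_nonpos_nonneg)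
      then show ?thesis using n by simp
    qed
    show ?thesis using lower upper by simp
  qed
  then show "(1 - 2 * C1 * \<epsilon>) * D x y \<le> norm (f x - f y)" "norm (f x - f y) \<le> (1 + 2 * C1 * \<epsilon>) * D x y"
    by (simp_all add: a_def n_def d_def)
qed

text \<open>The image of a nearly shortest curve, measured along a partition so fine that the local bound
applies to each step, is at most \<open>b\<close> times longer than the curve.\<close>
lemma geodesic_dist_image_le:
  fixes f :: "'a \<Rightarrow> 'b::real_normed_vector"
  assumes f: "continuous_on M f" and b: "0 \<le> b" and \<epsilon>: "0 < \<epsilon>"
    and le: "\<And>x y. x \<in> M \<Longrightarrow> y \<in> M \<Longrightarrow> D x y \<le> \<epsilon> \<Longrightarrow> norm (f x - f y) \<le> b * D x y"
    and xy: "x \<in> M" "y \<in> M"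
  shows "geodesic_dist (f ` M) (f x) (f y) \<le> ereal (b * D x y)"
proof -
  have "geodesic_dist (f ` M) (f x) (f y) \<le> ereal (b * (D x y + \<eta>))" if \<eta>: "0 < \<eta>" for \<eta>
  proof -
    have "geodesic_dist M x y < ereal (D x y + \<eta>)" using \<eta> by (simp add: geodesic_dist_eq_D xy)
    then obtain \<theta> where \<theta>: "\<theta> \<in> curves_joining M x y" "curve_length \<theta> < ereal (D x y + \<eta>)"
      unfolding geodesic_dist_def INF_less_iff by blast
    note th = curve_in_M[OF \<theta>(1)]
    have "continuous_on {0..1} (f \<circ> \<theta>)"
      using th by (intro continuous_on_compose continuous_on_subset[OF f]) auto
    then have "f \<circ> \<theta> \<in> curves_joining (f ` M) (f x) (f y)"
      using th by (auto simp: curves_joining_def path_def path_image_def pathstart_def pathfinish_def)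
    then have "geodesic_dist (f ` M) (f x) (f y) \<le> curve_length (f \<circ> \<theta>)"
      unfolding geodesic_dist_def by (rule INF_lower)
    also have "\<dots> \<le> ereal (b * (D x y + \<eta>))"
    proof (rule curve_length_leI)
      fix N t assume t: "unit_partition N t"
      obtain N' t' where t': "unit_refinement N t N' t'"
        "\<And>i. i < N' \<Longrightarrow> D (\<theta> (t' i)) (\<theta> (t' (Suc i))) \<le> \<epsilon>"
        using fine_refinement[OF \<theta>(1) t \<epsilon> zero_less_one] by metis
      note part = unit_refinement_partition[OF t'(1)]
      have "(\<Sum>i<N. norm (f (\<theta> (t i)) - f (\<theta> (t (Suc i))))) \<le>
          (\<Sum>i<N'. norm (f (\<theta> (t' i)) - f (\<theta> (t' (Suc i)))))"
        by (rule unit_refinement_sum_le[OF t'(1)]) (auto simp flip: dist_norm intro: dist_triangle)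
      also have "\<dots> \<le> (\<Sum>i<N'. b * D (\<theta> (t' i)) (\<theta> (t' (Suc i))))"
        using t'(2) unit_partition_range[OF part] by (intro sum_mono le th(2)) auto
      also have "\<dots> = b * (\<Sum>i<N'. D (\<theta> (t' i)) (\<theta> (t' (Suc i))))" by (simp add: sum_distrib_left)
      also have "\<dots> \<le> b * (D x y + \<eta>)"
      proof (rule mult_left_mono[OF _ b])
        have "ereal (\<Sum>i<N'. D (\<theta> (t' i)) (\<theta> (t' (Suc i)))) < ereal (D x y + \<eta>)"
          using D_sum_le_curve_length[OF \<theta>(1) part] \<theta>(2) by (rule le_less_trans)
        then show "(\<Sum>i<N'. D (\<theta> (t' i)) (\<theta> (t' (Suc i)))) \<le> D x y + \<eta>" by simp
      qed
      finally show "ereal (\<Sum>i<N. dist ((f \<circ> \<theta>) (t (Suc i))) ((f \<circ> \<theta>) (t i))) \<le> ereal (b * (D x y + \<eta>))"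
        by (simp add: dist_norm norm_minus_commute)
    qed
    finally show ?thesis .
  qed
  note bound = this
  show ?thesis
  proof (rule ereal_le_epsilon)
    fix e' :: ereal assume "0 < e'"
    then obtain e :: real where e: "e > 0" "ereal e \<le> e'"
      by (metis ereal_dense2 ereal_less(2) less_imp_le)
    have "geodesic_dist (f ` M) (f x) (f y) \<le> ereal (b * (D x y + e / (b + 1)))"
      using e b by (intro bound) simp
    also have "b * (e / (b + 1)) \<le> e" using e b by (simp add: pos_divide_le_eq algebra_simps)
    then have "ereal (b * (D x y + e / (b + 1))) \<le> ereal (b * D x y) + ereal e"
      by (simp add: distrib_left)
    also have "\<dots> \<le> ereal (b * D x y) + e'" using e by (intro add_left_mono)
    finally show "geodesic_dist (f ` M) (f x) (f y) \<le> ereal (b * D x y) + e'" .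
  qed
qed

text \<open>By compactness \<open>f\<close> is a homeomorphism onto its image, so a curve in the image lifts to a curve in
\<open>M\<close>. The triangle inequality for \<open>D\<close> along a fine partition of the lift bounds \<open>D x y\<close>.\<close>
lemma geodesic_dist_image_ge:
  fixes f :: "'a \<Rightarrow> 'b::real_normed_vector"
  assumes f: "continuous_on M f" "inj_on f M" and \<epsilon>: "0 < \<epsilon>"
    and ge: "\<And>x y. x \<in> M \<Longrightarrow> y \<in> M \<Longrightarrow> D x y \<le> \<epsilon> \<Longrightarrow> b * D x y \<le> norm (f x - f y)"
    and xy: "x \<in> M" "y \<in> M"
  shows "ereal (b * D x y) \<le> geodesic_dist (f ` M) (f x) (f y)"
  unfolding geodesic_dist_def
proof (rule INF_greatest)
  fix \<sigma> assume \<sigma>: "\<sigma> \<in> curves_joining (f ` M) (f x) (f y)"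
  show "ereal (b * D x y) \<le> curve_length \<sigma>"
  \<comment> \<open>For \<open>b \<le> 0\<close> the bound is trivial; in the application it occurs when \<open>2 * C1 * \<epsilon> \<ge> 1\<close>.\<close>
  proof (cases "b \<le> 0")
    case True
    then have "ereal (b * D x y) \<le> 0" using D_nonneg[OF xy] by (simp add: mult_nonpos_nonneg)
    then show ?thesis using curve_length_nonneg order_trans by blast
  next
    case False
    have s: "continuous_on {0..1} \<sigma>" "\<sigma> ` {0..1} \<subseteq> f ` M" "\<sigma> 0 = f x" "\<sigma> 1 = f y"
      using \<sigma> by (auto simp: curves_joining_def path_def path_image_def pathstart_def pathfinish_def)
    define \<theta> where "\<theta> = inv_into M f \<circ> \<sigma>"
    have "continuous_on (f ` M) (inv_into M f)" by (rule continuous_on_inv[OF f(1) compact]) (simp add: f(2))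
    then have "continuous_on (\<sigma> ` {0..1}) (inv_into M f)" using s(2) by (rule continuous_on_subset)
    with s(1) have "continuous_on {0..1} \<theta>" unfolding \<theta>_def by (rule continuous_on_compose)
    then have \<theta>: "\<theta> \<in> curves_joining M x y"
      using s f(2) xy
      by (auto simp: curves_joining_def path_def path_image_def pathstart_def pathfinish_def \<theta>_def
          image_subset_iff inv_into_into)
    note th = curve_in_M[OF \<theta>]
    have f\<theta>: "f (\<theta> t) = \<sigma> t" if "t \<in> {0..1}" for t
      using s(2) that by (auto simp: \<theta>_def f_inv_into_f image_subset_iff)
    have "unit_partition 1 real" by (rule unit_partition_stepI) auto
    then obtain N' t' where t': "unit_refinement 1 real N' t'"
      "\<And>i. i < N' \<Longrightarrow> D (\<theta> (t' i)) (\<theta> (t' (Suc i))) \<le> \<epsilon>"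
      using fine_refinement[OF \<theta> _ \<epsilon> zero_less_one] by metis
    note part = unit_refinement_partition[OF t'(1)]
    have r: "t' i \<in> {0..1}" if "i \<le> N'" for i using unit_partition_range[OF part that] by simp
    have "(\<Sum>i<1. D (\<theta> (real i)) (\<theta> (real (Suc i)))) \<le> (\<Sum>i<N'. D (\<theta> (t' i)) (\<theta> (t' (Suc i))))"
      by (rule unit_refinement_sum_le[OF t'(1)]) (intro D_refl D_triangle th(2); assumption)+
    then have "D x y \<le> (\<Sum>i<N'. D (\<theta> (t' i)) (\<theta> (t' (Suc i))))" using th(3,4) by simp
    then have "b * D x y \<le> b * (\<Sum>i<N'. D (\<theta> (t' i)) (\<theta> (t' (Suc i))))"
      using False by (intro mult_left_mono) auto
    also have "\<dots> = (\<Sum>i<N'. b * D (\<theta> (t' i)) (\<theta> (t' (Suc i))))" by (simp add: sum_distrib_left)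
    also have "\<dots> \<le> (\<Sum>i<N'. norm (f (\<theta> (t' i)) - f (\<theta> (t' (Suc i)))))"
      using t'(2) r by (intro sum_mono ge th(2)) auto
    also have "\<dots> = (\<Sum>i<N'. dist (\<sigma> (t' (Suc i))) (\<sigma> (t' i)))"
      using r by (intro sum.cong) (auto simp: f\<theta> dist_norm norm_minus_commute)
    finally have "ereal (b * D x y) \<le> ereal (\<Sum>i<N'. dist (\<sigma> (t' (Suc i))) (\<sigma> (t' i)))" by simp
    also have "\<dots> \<le> curve_length \<sigma>" by (rule partition_sum_le_curve_length[OF part])
    finally show ?thesis .
  qed
qed

lemma minimizer_geodesic_bounds:
  assumes f: "minimizer M x0 C2 \<epsilon> M f" and \<epsilon>: "0 < \<epsilon>" "\<epsilon> \<le> \<epsilon>0" and "0 < C2"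
    and C2: "\<And>x y. x \<in> M \<Longrightarrow> y \<in> M \<Longrightarrow> C2 * D x y \<le> norm (x - y)"
    and xy: "x \<in> M" "y \<in> M"
  shows "ereal ((1 - 2 * C1 * \<epsilon>) * D x y) \<le> geodesic_dist (f ` M) (f x) (f y)"
    and "geodesic_dist (f ` M) (f x) (f y) \<le> ereal ((1 + 2 * C1 * \<epsilon>) * D x y)"
proof -
  note iso = minimizer_almost_isometric[OF f \<epsilon> C2]
  have cont: "continuous_on M f" and sep: "\<And>x y. x \<in> M \<Longrightarrow> y \<in> M \<Longrightarrow> C2 * D x y \<le> norm (f x - f y)"
    using f by (auto simp: minimizer_iff admissible_iff)
  have inj: "inj_on f M"
  proof (rule inj_onI, rule ccontr)
    fix x y assume xy: "x \<in> M" "y \<in> M" "f x = f y" "x \<noteq> y"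
    then have "0 < C2 * D x y" using \<open>0 < C2\<close> D_pos_iff by simp
    then show False using sep[OF xy(1,2)] xy(3) by simp
  qed
  show "geodesic_dist (f ` M) (f x) (f y) \<le> ereal ((1 + 2 * C1 * \<epsilon>) * D x y)"
    by (rule geodesic_dist_image_le[OF cont _ \<epsilon>(1) iso(2) xy]) (use C1_pos \<epsilon> in auto)
  show "ereal ((1 - 2 * C1 * \<epsilon>) * D x y) \<le> geodesic_dist (f ` M) (f x) (f y)"
    by (rule geodesic_dist_image_ge[OF cont inj \<epsilon>(1) iso(1) xy]) auto
qed

end

section \<open>Existence, convergence and near-isometry of minimizers\<close>

theorem theorem4p1:
  fixes M :: "'a::euclidean_space set"
    and S :: "nat \<Rightarrow> 'a set"
    and \<epsilon>0 C1 :: real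
  assumes "compact M"
    and "rectifiably_connected M"
    and "\<epsilon>0 > 0" and "C1 > 0"
    and "\<And>x y. x \<in> M \<Longrightarrow> y \<in> M \<Longrightarrow> geodesic_dist M x y \<le> ereal \<epsilon>0 \<Longrightarrow>
           geodesic_dist M x y \<le> ereal (norm (x - y) + C1 * (norm (x - y))\<^sup>2)"
    and "\<And>k. closed (S k)" and "\<And>k. S k \<subseteq> M"
    and "(\<lambda>k. hausdorff_dist (S k) M) \<longlonglongrightarrow> 0"
  shows "\<forall>\<epsilon>>0. \<exists>kbar. \<forall>x0\<in>M. \<forall>C2. 0 < C2 \<and> ereal C2 \<le> chord_arc_const M \<longrightarrow>
    \<comment> \<open>(i)\<close>
    (\<forall>k\<ge>kbar. \<exists>f. minimizer M x0 C2 \<epsilon> (S k) f) \<and>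
    \<comment> \<open>(ii)\<close>
    (\<forall>f. (\<forall>k\<ge>kbar. minimizer M x0 C2 \<epsilon> (S k) (f k)) \<longrightarrow>
      (equicontinuous_seq M {kbar..} f \<longrightarrow>
        (\<exists>r h. strict_mono r \<and> uniform_limit M (\<lambda>j. f (r j)) h sequentially \<and>
               minimizer M x0 C2 \<epsilon> M h)) \<and>
      (\<exists>g. (\<forall>k\<ge>kbar. minimizer M x0 C2 \<epsilon> (S k) (g k) \<and> (\<exists>c. \<forall>x\<in>S k. g k x = f k x + c)) \<and>
           equicontinuous_seq M {kbar..} g) \<and>
      (\<forall>r h. strict_mono r \<and> uniform_limit M (\<lambda>j. f (r j)) h sequentially \<longrightarrow>
             minimizer M x0 C2 \<epsilon> M h \<and>
             (\<lambda>j. hausdorff_dist (f (r j) ` M) (h ` M)) \<longlonglongrightarrow> 0)) \<and>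
    \<comment> \<open>(iii)\<close>
    (\<forall>f. \<epsilon> < \<epsilon>0 \<and> minimizer M x0 C2 \<epsilon> M f \<longrightarrow>
      (\<forall>x\<in>M. \<forall>y\<in>M. geodesic_dist M x y \<le> ereal \<epsilon> \<longrightarrow>
         geodesic_dist M x y * ereal (1 - 2 * C1 * \<epsilon>) \<le> ereal (norm (f x - f y)) \<and>
         ereal (norm (f x - f y)) \<le> geodesic_dist M x y * ereal (1 + 2 * C1 * \<epsilon>)) \<and>
      (\<forall>x\<in>M. \<forall>y\<in>M.
         geodesic_dist M x y * ereal (1 - 2 * C1 * \<epsilon>) \<le> geodesic_dist (f ` M) (f x) (f y) \<and>
         geodesic_dist (f ` M) (f x) (f y) \<le> geodesic_dist M x y * ereal (1 + 2 * C1 * \<epsilon>)))"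
    (is "\<forall>\<epsilon>>0. \<exists>kbar. \<forall>x0\<in>M. \<forall>C2. _ C2 \<longrightarrow> ?concl \<epsilon> kbar x0 C2")
proof (intro allI impI)
  fix \<epsilon> :: real assume \<epsilon>: "0 < \<epsilon>"
  note sub = \<open>\<And>k. S k \<subseteq> M\<close> and closed = \<open>\<And>k. closed (S k)\<close>
    and lim = \<open>(\<lambda>k. hausdorff_dist (S k) M) \<longlonglongrightarrow> 0\<close>
  show "\<exists>kbar. \<forall>x0\<in>M. \<forall>C2. 0 < C2 \<and> ereal C2 \<le> chord_arc_const M \<longrightarrow> ?concl \<epsilon> kbar x0 C2"
  proof (cases "\<exists>c. 0 < c \<and> ereal c \<le> chord_arc_const M")
    case False
    \<comment> \<open>Without a positive chord-arc constant no \<open>C2\<close> is admitted.\<close>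
    then show ?thesis by (intro exI[of _ 0] ballI allI impI) (erule notE, rule exI)
  next
    case True
    then obtain c where c: "0 < c" "ereal c \<le> chord_arc_const M" by blast
    interpret chord_arc_set M c \<epsilon>0 C1
      using assms(1-5) c chord_arc_const_lower_bound[OF assms(2) c(2)] by unfold_locales auto
    \<comment> \<open>The Euclidean distance \<open>c * \<epsilon> / 6\<close> corresponds to a geodesic distance of at most \<open>\<epsilon> / 6\<close>.
      \<open>kbar\<close> is fixed before \<open>x0\<close> and \<open>C2\<close>, hence the auxiliary constant \<open>c\<close>.\<close>
    have "0 < c * \<epsilon> / 6" using c \<epsilon> by simp
    from hausdorff_limit_dense[OF lim this]
    obtain kbar where kbar: "\<And>k x. kbar \<le> k \<Longrightarrow> x \<in> M \<Longrightarrow> \<exists>a\<in>S k. dist a x < c * \<epsilon> / 6"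
      unfolding eventually_sequentially by blast
    have dense: "\<exists>a\<in>S k. D z a \<le> \<epsilon> / 6" if k: "kbar \<le> k" and z: "z \<in> M" for k z
    proof -
      obtain a where a: "a \<in> S k" "dist a z < c * \<epsilon> / 6" using kbar[OF k z] by blast
      have "D z a \<le> norm (z - a) / c" by (rule D_le_norm) (use z a sub in auto)
      also have "\<dots> \<le> \<epsilon> / 6"
        using a(2) c by (simp add: dist_norm norm_minus_commute pos_divide_le_eq mult.commute)
      finally show ?thesis using a(1) by blast
    qed
    show ?thesis
    proof (intro exI[of _ kbar] ballI allI impI)
      fix x0 C2 assume x0: "x0 \<in> M" and C2': "0 < C2 \<and> ereal C2 \<le> chord_arc_const M"
      have C2: "C2 * D x y \<le> norm (x - y)" if "x \<in> M" "y \<in> M" for x y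
        using chord_arc_const_lower_bound[OF assms(2) _ that, of C2] C2' that
        by (simp add: geodesic_dist_eq_D)
      have existence: "\<exists>f. minimizer M x0 C2 \<epsilon> (S k) f" if "kbar \<le> k" for k
        by (rule minimizer_exists[OF sub dense[OF that] \<epsilon> x0 C2])
      show "?concl \<epsilon> kbar x0 C2"
      proof (intro conjI allI impI ballI)
        fix k assume "kbar \<le> k"
        then show "\<exists>f. minimizer M x0 C2 \<epsilon> (S k) f" by (rule existence)
      next
        fix f assume f: "\<forall>k\<ge>kbar. minimizer M x0 C2 \<epsilon> (S k) (f k)"
          and "equicontinuous_seq M {kbar..} f"
        then show "\<exists>r h. strict_mono r \<and> uniform_limit M (\<lambda>j. f (r j)) h sequentially \<and>
          minimizer M x0 C2 \<epsilon> M h" by (intro minimizers_along_Hausdorff_limit(1)[OF \<epsilon> closed sub lim dense x0 C2 f])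
      next
        fix f assume f: "\<forall>k\<ge>kbar. minimizer M x0 C2 \<epsilon> (S k) (f k)"
        then show "\<exists>g. (\<forall>k\<ge>kbar. minimizer M x0 C2 \<epsilon> (S k) (g k) \<and> (\<exists>c. \<forall>x\<in>S k. g k x = f k x + c)) \<and>
          equicontinuous_seq M {kbar..} g" by (intro minimizers_along_Hausdorff_limit(2)[OF \<epsilon> closed sub lim dense x0 C2 f])
      next
        fix f r h assume f: "\<forall>k\<ge>kbar. minimizer M x0 C2 \<epsilon> (S k) (f k)"
          and r: "strict_mono r \<and> uniform_limit M (\<lambda>j. f (r j)) h sequentially"
        from r show "minimizer M x0 C2 \<epsilon> M h" by (elim conjE) (rule minimizers_along_Hausdorff_limit(3)[OF \<epsilon> closed sub lim dense x0 C2 f])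
        from r show "(\<lambda>j. hausdorff_dist (f (r j) ` M) (h ` M)) \<longlonglongrightarrow> 0"
          by (elim conjE) (rule hausdorff_dist_uniform_limit)
      next
        fix f x y assume f: "\<epsilon> < \<epsilon>0 \<and> minimizer M x0 C2 \<epsilon> M f" and xy: "x \<in> M" "y \<in> M"
          and near: "geodesic_dist M x y \<le> ereal \<epsilon>"
        have "D x y \<le> \<epsilon>" using near xy by (simp add: geodesic_dist_eq_D)
        note iso = minimizer_almost_isometric[OF conjunct2[OF f] \<epsilon> less_imp_le[OF conjunct1[OF f]] C2 xy this]
        show "geodesic_dist M x y * ereal (1 - 2 * C1 * \<epsilon>) \<le> ereal (norm (f x - f y))"
          using iso(1) xy by (simp add: geodesic_dist_eq_D mult.commute)
        show "ereal (norm (f x - f y)) \<le> geodesic_dist M x y * ereal (1 + 2 * C1 * \<epsilon>)"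
          using iso(2) xy by (simp add: geodesic_dist_eq_D mult.commute)
      next
        fix f x y assume f: "\<epsilon> < \<epsilon>0 \<and> minimizer M x0 C2 \<epsilon> M f" and xy: "x \<in> M" "y \<in> M"
        note bounds = minimizer_geodesic_bounds[OF conjunct2[OF f] \<epsilon> less_imp_le[OF conjunct1[OF f]] conjunct1[OF C2'] C2 xy]
        show "geodesic_dist M x y * ereal (1 - 2 * C1 * \<epsilon>) \<le> geodesic_dist (f ` M) (f x) (f y)"
          using bounds(1) xy by (simp add: geodesic_dist_eq_D mult.commute)
        show "geodesic_dist (f ` M) (f x) (f y) \<le> geodesic_dist M x y * ereal (1 + 2 * C1 * \<epsilon>)"
          using bounds(2) xy by (simp add: geodesic_dist_eq_D mult.commute)
      qed
    qed
  qed
qed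

end
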